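(* Fix $\sigma>0$, $N\ge1$ and $\beta>0$. Assume that the noise distribution $\Psi$ satisfies [Shape] and [Decay]. Then, in dimension $d=1$, the optimally tuned worst-case risk of median filtering over $\mathrm{PLIP}=\mathrm{PLIP}(\beta,N)$ satisfies $$\inf_{h>0}\mathcal{R}_n(M_h;\mathrm{PLIP})\asymp n^{-1/2},\qquad n\to\infty .$$
   Context: Model ($d=1$): let $\mathbb{I}_n=\{1,\dots,n\}$. One observes $Y_n(i)=f(i/n)+\sigma Z_n(i)$, $i\in\mathbb{I}_n$, where $f:[0,1]\to[0,1]$ is unknown, $\sigma>0$ is a fixed noise level and $(Z_n(i))_{i\in\mathbb{I}_n}$ is white noise, i.e. i.i.d. random variables with distribution $\Psi$. Conditions on $\Psi$. [Shape]: $\Psi$ has a density $\psi$ with respect to Lebesgue measure on $\mathbb{R}$, with $\psi$ unimodal, continuous and symmetric about $0$. [Decay]: $\zeta(\Psi):=\sup\{s>0:\psi(x)(|x|+1)^s\text{ is bounded in }x\}>1$. Median filter: for $h>0$ let $\mathcal{W}[n,h](i)=\{j\in\mathbb{I}_n:|j-i|\le nh\}$ and $M_h[Y_n](i)=\mathrm{Median}\{Y_n(j):j\in\mathcal{W}[n,h](i)\}$ (empirical median). Risk: for an estimator $T$, $\mathcal{R}_n(T;f)=\frac1n\sum_{i\in\mathbb{I}_n}\mathbb{E}[(T[Y_n](i)-f(i/n))^2]$, and for a class $\mathcal{F}$ of functions, $\mathcal{R}_n(T;\mathcal{F})=\sup_{f\in\mathcal{F}}\mathcal{R}_n(T;f)$.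 Function class: the local Lipschitz constant of $f$ at $x$ is $\mathrm{Lip}_x(f)=\limsup_{\varepsilon\to0}\sup_{|y-x|\le\varepsilon,\,y\ne x}\frac{|f(y)-f(x)|}{|y-x|}$. $\mathrm{PLIP}(\beta,N)$ is the collection of functions $f:[0,1]\to[0,1]$ having local Lipschitz constant bounded by $\beta$ at every point of the complement of some finite set $(x_i)_{i=1}^N\subset(0,1)$ (the set may depend on $f$). $a_n\asymp b_n$ means that the ratio $a_n/b_n$ is bounded away from $0$ and $\infty$ as $n$ becomes large (constants may depend on $\sigma,\beta,N,\Psi$). *)

theory Defs
  imports "HOL-Probability.Probability"
begin

definition unimodal :: "(real \<Rightarrow> real) \<Rightarrow> bool" where
  "unimodal \<psi> \<longleftrightarrow> (\<exists>m. mono_on {..m} \<psi> \<and> antimono_on {m..} \<psi>)"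

definition shape_cond :: "real measure \<Rightarrow> (real \<Rightarrow> real) \<Rightarrow> bool" where
  "shape_cond \<Psi> \<psi> \<longleftrightarrow>
     (\<forall>x. 0 \<le> \<psi> x) \<and> \<Psi> = density lborel (\<lambda>x. ennreal (\<psi> x)) \<and>
     unimodal \<psi> \<and> continuous_on UNIV \<psi> \<and> (\<forall>x. \<psi> (- x) = \<psi> x)"

text \<open>The supremum is taken in the extended reals, since all exponents may be admissible
  (e.g. for Gaussian noise).\<close>

definition decay_exponent :: "(real \<Rightarrow> real) \<Rightarrow> ereal" where
  "decay_exponent \<psi> =
     Sup (ereal ` {s. 0 < s \<and> bounded (range (\<lambda>x. \<psi> x * (\<bar>x\<bar> + 1) powr s))})"

definition white_noise ::
  "'a measure \<Rightarrow> real measure \<Rightarrow> (nat \<Rightarrow> nat \<Rightarrow> 'a \<Rightarrow> real) \<Rightarrow> bool" where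
  "white_noise M \<Psi> Z \<longleftrightarrow>
     (\<forall>n. prob_space.indep_vars M (\<lambda>_. borel) (Z n) {1..n} \<and>
          (\<forall>i\<in>{1..n}. distr M borel (Z n i) = \<Psi>))"

definition observation ::
  "(nat \<Rightarrow> nat \<Rightarrow> 'a \<Rightarrow> real) \<Rightarrow> real \<Rightarrow> (real \<Rightarrow> real) \<Rightarrow> nat \<Rightarrow> 'a \<Rightarrow> nat \<Rightarrow> real" where
  "observation Z \<sigma> f n \<omega> i = f (real i / real n) + \<sigma> * Z n i \<omega>"

text \<open>Empirical median of the family \<open>(y j)\<close>, \<open>j \<in> W\<close>, counted with multiplicity. For an
  even number of observations it is the mean of the two middle order statistics.\<close>

definition empirical_median :: "nat set \<Rightarrow> (nat \<Rightarrow> real) \<Rightarrow> real" where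
  "empirical_median W y =
     (let xs = sort (map y (sorted_list_of_set W)); m = length xs
      in (xs ! ((m - 1) div 2) + xs ! (m div 2)) / 2)"

definition window :: "nat \<Rightarrow> real \<Rightarrow> nat \<Rightarrow> nat set" where
  "window n h i = {j\<in>{1..n}. \<bar>real j - real i\<bar> \<le> real n * h}"

definition median_filter :: "nat \<Rightarrow> real \<Rightarrow> (nat \<Rightarrow> real) \<Rightarrow> nat \<Rightarrow> real" where
  "median_filter n h y i = empirical_median (window n h i) y"

text \<open>The risk takes values in \<open>[0,\<infinity>]\<close>: the noise need not have finite variance, so for narrow
  windows the mean squared error can be infinite.\<close>

definition risk ::
  "'a measure \<Rightarrow> (nat \<Rightarrow> nat \<Rightarrow> 'a \<Rightarrow> real) \<Rightarrow> real \<Rightarrow> nat \<Rightarrow>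
   ((nat \<Rightarrow> real) \<Rightarrow> nat \<Rightarrow> real) \<Rightarrow> (real \<Rightarrow> real) \<Rightarrow> ennreal" where
  "risk M Z \<sigma> n T f =
     (\<Sum>i\<in>{1..n}. \<integral>\<^sup>+ \<omega>. ennreal ((T (observation Z \<sigma> f n \<omega>) i - f (real i / real n))\<^sup>2) \<partial>M)
       / of_nat n"

definition worst_case_risk ::
  "'a measure \<Rightarrow> (nat \<Rightarrow> nat \<Rightarrow> 'a \<Rightarrow> real) \<Rightarrow> real \<Rightarrow> nat \<Rightarrow>
   ((nat \<Rightarrow> real) \<Rightarrow> nat \<Rightarrow> real) \<Rightarrow> (real \<Rightarrow> real) set \<Rightarrow> ennreal" where
  "worst_case_risk M Z \<sigma> n T F = (SUP f\<in>F. risk M Z \<sigma> n T f)"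

definition local_Lip :: "(real \<Rightarrow> real) \<Rightarrow> real \<Rightarrow> ereal" where
  "local_Lip f x =
     Limsup (at_right 0)
       (\<lambda>\<epsilon>. SUP y\<in>{y\<in>{0..1}. \<bar>y - x\<bar> \<le> \<epsilon> \<and> y \<noteq> x}. ereal (\<bar>f y - f x\<bar> / \<bar>y - x\<bar>))"

text \<open>Functions on \<open>[0,1]\<close> are represented by functions on the reals, whose values outside
  \<open>[0,1]\<close> are unconstrained and never used.\<close>

definition PLIP :: "real \<Rightarrow> nat \<Rightarrow> (real \<Rightarrow> real) set" where
  "PLIP \<beta> N =
     {f \<in> {0..1} \<rightarrow> {0..1}.
        \<exists>x :: nat \<Rightarrow> real. x ` {1..N} \<subseteq> {0<..<1} \<and>
          (\<forall>t\<in>{0..1} - x ` {1..N}. local_Lip f t \<le> ereal \<beta>)}"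

definition same_order :: "(nat \<Rightarrow> ennreal) \<Rightarrow> (nat \<Rightarrow> ennreal) \<Rightarrow> bool" where
  "same_order a b \<longleftrightarrow>
     (\<exists>c C :: real. 0 < c \<and>
        (\<forall>\<^sub>F n in sequentially. ennreal c \<le> a n / b n \<and> a n / b n \<le> ennreal C))"

end

theory Submission
  imports Defs
begin

text \<open>
  Why the rate is \<open>n\<^sup>-\<^sup>1\<^sup>/\<^sup>2\<close>: a window of half-width \<open>h\<close> holds about \<open>n h\<close> observations. The median
  of that many centred noise variables has mean square of order \<open>1 / (n h)\<close>, and a jump spoils the
  estimate, with an error of constant size, at a fraction of order \<open>h\<close> of the design points. The two
  contributions balance at \<open>h = n\<^sup>-\<^sup>1\<^sup>/\<^sup>2\<close>. Away from the jumps the Lipschitz bias is only of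
  order \<open>h\<^sup>2 = 1 / n\<close>.

  Everything about the median is reduced to counting: at least half of the sample lies on either side of
  the empirical median (\<open>empirical_median_splits\<close>), so that a statement on where the median lies
  becomes a statement on a sum of independent indicators. Three arguments about such sums suffice.

  \<^item> A Chernoff bound (\<open>prob_majority_le\<close>): if events have average probability at most \<open>q \<le> 1/2\<close>, then
    half of \<open>m\<close> of them occur with probability at most \<open>(4 q (1 - q))\<^sup>m\<^sup>/\<^sup>2\<close>. For the upper bound it
    is applied to the events \<open>Z > t\<close> and \<open>Z < - t\<close>. Near \<open>0\<close> the factor \<open>4 q (1 - q)\<close> is at most
    \<open>1 - c t\<^sup>2\<close> because the density is positive at its mode, and for large \<open>t\<close> it decays like a power
    of \<open>t\<close> by the decay condition. Both are captured by the single majorant \<open>(1 + t\<^sup>2)\<^sup>-\<^sup>\<kappa>\<close>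
    (\<open>bernoulli_factor_le\<close>), whose \<open>m/2\<close>-th power is integrated in closed form; this gives
    \<open>median_mean_square_le\<close>.

  \<^item> The same bound shows that the median is biased near a jump (\<open>median_mean_square_ge_bias\<close>). If a
    fixed fraction of the window lies beyond the jump, fewer than half of the observations fall below
    some fixed level \<open>e > 0\<close>, up to an event of small probability. With the step function this gives
    the lower bound for windows that are too wide (\<open>risk_step_ge\<close>).

  \<^item> An anti-concentration bound (\<open>prob_balanced_count_le\<close>): the number of positive signs among \<open>m\<close> fair
    signs deviates from \<open>m / 2\<close> by order \<open>\<surd>m\<close> with positive probability. A median close to \<open>0\<close> would
    force this count to be balanced, up to the few observations close to \<open>0\<close>. Hence the mean square
    of the median of pure noise is at least of order \<open>1 / m\<close> (\<open>median_mean_square_ge_spread\<close>), which with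
    the zero function gives the lower bound for windows that are too narrow (\<open>risk_zero_ge\<close>).

  Every \<open>h > 0\<close> is too narrow or too wide in one of these two senses, with the border at
  \<open>n\<^sup>-\<^sup>1\<^sup>/\<^sup>2\<close>.
\<close>

section \<open>Empirical medians and majorities\<close>

text \<open>The empirical median is the mean of the two middle order statistics, hence lies between them.
Everything else about it is derived from this pair of counts.\<close>

lemma empirical_median_splits:
  assumes fin: "finite W" and ne: "W \<noteq> {}"
  shows "card W \<le> 2 * card {j\<in>W. y j \<le> empirical_median W y}"
    and "card W \<le> 2 * card {j\<in>W. empirical_median W y \<le> y j}"
proof -
  define ys where "ys = map y (sorted_list_of_set W)"
  define xs where "xs = sort ys"
  define m where "m = card W"
  let ?med = "empirical_median W y"
  have len: "length xs = m"
    by (simp add: xs_def ys_def m_def)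
  have m0: "0 < m"
    using fin ne by (simp add: m_def card_gt_0_iff)
  have med: "?med = (xs ! ((m - 1) div 2) + xs ! (m div 2)) / 2"
    by (simp add: empirical_median_def Let_def xs_def ys_def m_def)
  have sorted: "sorted xs" by (simp add: xs_def)
  have mono: "xs ! k \<le> xs ! l" if "k \<le> l" "l < m" for k l
    using sorted_nth_mono[OF sorted] that len by simp
  have "xs ! ((m - 1) div 2) \<le> xs ! (m div 2)"
    using m0 by (intro mono) auto
  then have lo: "xs ! ((m - 1) div 2) \<le> ?med" and hi: "?med \<le> xs ! (m div 2)"
    unfolding med by auto
  have count: "card {j\<in>W. P (y j)} = card {k. k < m \<and> P (xs ! k)}" for P
  proof -
    have "card {k. k < m \<and> P (xs ! k)} = length (filter P xs)"
      by (simp add: length_filter_conv_card len)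
    also have "\<dots> = length (filter P ys)"
      unfolding xs_def by (metis filter_sort length_sort)
    also have "\<dots> = length (filter (\<lambda>j. P (y j)) (sorted_list_of_set W))"
      by (simp add: ys_def filter_map comp_def)
    also have "\<dots> = card (set (filter (\<lambda>j. P (y j)) (sorted_list_of_set W)))"
      by (rule distinct_card[symmetric]) simp
    also have "set (filter (\<lambda>j. P (y j)) (sorted_list_of_set W)) = {j\<in>W. P (y j)}"
      using fin by auto
    finally show ?thesis by simp
  qed
  have "{..(m - 1) div 2} \<subseteq> {k. k < m \<and> xs ! k \<le> ?med}"
    using m0 lo mono by (fastforce intro: order_trans)
  then have "card {..(m - 1) div 2} \<le> card {k. k < m \<and> xs ! k \<le> ?med}"
    by (intro card_mono) auto
  then show "card W \<le> 2 * card {j\<in>W. y j \<le> ?med}"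
    using count[of "\<lambda>x. x \<le> ?med"] by (simp add: m_def)
  have "{m div 2..<m} \<subseteq> {k. k < m \<and> ?med \<le> xs ! k}"
    using hi mono by (fastforce intro: order_trans)
  then have "card {m div 2..<m} \<le> card {k. k < m \<and> ?med \<le> xs ! k}"
    by (intro card_mono) auto
  then show "card W \<le> 2 * card {j\<in>W. ?med \<le> y j}"
    using count[of "\<lambda>x. ?med \<le> x"] by (simp add: m_def)
qed

lemma card_levels_measurable [measurable]:
  assumes [measurable]: "\<And>j. j \<in> W \<Longrightarrow> Measurable.pred N (\<lambda>x. P j x)" and fin: "finite W"
  shows "(\<lambda>x. card {j\<in>W. P j x}) \<in> measurable N (count_space UNIV)"
proof -
  have "(\<lambda>x. card {j\<in>W. P j x}) = (\<lambda>x. \<Sum>j\<in>W. if P j x then 1 else 0)"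
    using fin by (auto simp: sum.If_cases Int_def)
  then show ?thesis by simp
qed

context prob_space
begin

text \<open>Chernoff's method with the exponential base \<open>\<theta> = (1 - q) / q\<close>, the optimal one for the binomial
distribution with parameter \<open>q\<close> at level \<open>m / 2\<close>. The probabilities may differ: only their average is
bounded, which is what a window containing a jump requires.\<close>

lemma prob_majority_le:
  fixes X :: "'i \<Rightarrow> 'a \<Rightarrow> real" and q :: real
  assumes ind: "indep_vars (\<lambda>_. borel) X W" and fin: "finite W"
    and A: "\<And>j. j \<in> W \<Longrightarrow> A j \<in> sets borel"
    and q: "0 < q" "q \<le> 1/2"
    and sum_le: "(\<Sum>j\<in>W. prob {\<omega>\<in>space M. X j \<omega> \<in> A j}) \<le> card W * q"
  shows "prob {\<omega>\<in>space M. card W \<le> 2 * card {j\<in>W. X j \<omega> \<in> A j}} \<le> sqrt (4 * q * (1 - q)) ^ card W"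
proof -
  have [simp]: "{\<omega>\<in>space M. P \<omega>} \<inter> space M = {\<omega>\<in>space M. P \<omega>}" for P
    by auto
  define \<theta> where "\<theta> = (1 - q) / q"
  define Y where "Y = (\<lambda>j \<omega>. if X j \<omega> \<in> A j then \<theta> else 1)"
  define p where "p = (\<lambda>j. prob {\<omega>\<in>space M. X j \<omega> \<in> A j})"
  define m where "m = card W"
  have \<theta>1: "1 \<le> \<theta>" using q by (simp add: \<theta>_def field_simps)
  have rv [measurable]: "random_variable borel (X j)" if "j \<in> W" for j
    using ind that unfolding indep_vars_def by auto
  note A[measurable]
  have indY: "indep_vars (\<lambda>_. borel) Y W"
    unfolding Y_def using A
    by (intro indep_vars_compose2[OF ind, where Y = "\<lambda>j x. if x \<in> A j then \<theta> else 1"]) auto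
  have intY: "integrable M (Y j)" if "j \<in> W" for j
    using that \<theta>1 unfolding Y_def by (intro integrable_const_bound[where B = \<theta>]) auto
  have indA: "integrable M (\<lambda>\<omega>. indicator {\<omega>\<in>space M. X j \<omega> \<in> A j} \<omega> :: real)" if "j \<in> W" for j
    using that by (intro integrable_real_indicator) (auto simp: less_top[symmetric])
  have expY: "expectation (Y j) = 1 + p j * (\<theta> - 1)" if j: "j \<in> W" for j
  proof -
    have "expectation (Y j) = expectation (\<lambda>\<omega>. 1 + (\<theta> - 1) * indicator {\<omega>\<in>space M. X j \<omega> \<in> A j} \<omega>)"
      by (rule Bochner_Integration.integral_cong) (auto simp: Y_def)
    also have "\<dots> = 1 + (\<theta> - 1) * p j"
      using indA[OF j] by (subst Bochner_Integration.integral_add) (auto simp: p_def prob_space)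
    finally show ?thesis by (simp add: mult.commute)
  qed
  have base: "1 + q * (\<theta> - 1) = 2 * (1 - q)"
    using q by (simp add: \<theta>_def field_simps)
  have "expectation (\<lambda>\<omega>. \<Prod>j\<in>W. Y j \<omega>) = (\<Prod>j\<in>W. expectation (Y j))"
    by (rule indep_vars_lebesgue_integral[OF fin indY intY])
  \<comment> \<open>Factoring out the value at \<open>p j = q\<close> and applying \<open>1 + x \<le> exp x\<close> leaves an exponent
    that is linear in \<open>p j - q\<close>, so that only the sum of the probabilities enters.\<close>
  also have "\<dots> \<le> (\<Prod>j\<in>W. (2 * (1 - q)) * exp ((p j - q) * ((\<theta> - 1) / (2 * (1 - q)))))"
  proof (intro prod_mono conjI)
    fix j assume j: "j \<in> W"
    show "0 \<le> expectation (Y j)"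
      using \<theta>1 by (simp add: Y_def)
    have "expectation (Y j) = 2 * (1 - q) * (1 + (p j - q) * ((\<theta> - 1) / (2 * (1 - q))))"
    proof -
      have "2 * (1 - q) * (1 + (p j - q) * ((\<theta> - 1) / (2 * (1 - q)))) = 2 * (1 - q) + (p j - q) * (\<theta> - 1)"
        using q by (simp add: distrib_left)
      also have "\<dots> = 1 + p j * (\<theta> - 1)"
        unfolding base[symmetric] by (simp add: algebra_simps)
      finally show ?thesis by (simp add: expY[OF j])
    qed
    also have "\<dots> \<le> 2 * (1 - q) * exp ((p j - q) * ((\<theta> - 1) / (2 * (1 - q))))"
      using q by (intro mult_left_mono exp_ge_add_one_self) auto
    finally show "expectation (Y j) \<le> 2 * (1 - q) * exp ((p j - q) * ((\<theta> - 1) / (2 * (1 - q))))" .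
  qed
  also have "\<dots> = (2 * (1 - q)) ^ m * exp ((\<Sum>j\<in>W. p j - q) * ((\<theta> - 1) / (2 * (1 - q))))"
    unfolding sum_distrib_right exp_sum[OF fin] prod.distrib m_def prod_constant power_mult_distrib ..
  also have "\<dots> \<le> (2 * (1 - q)) ^ m"
  proof -
    have "(\<Sum>j\<in>W. p j - q) * ((\<theta> - 1) / (2 * (1 - q))) \<le> 0"
      using sum_le q \<theta>1 by (intro mult_nonpos_nonneg) (auto simp: sum_subtractf p_def)
    then show ?thesis
      using q by (intro mult_left_le) auto
  qed
  finally have E: "expectation (\<lambda>\<omega>. \<Prod>j\<in>W. Y j \<omega>) \<le> (2 * (1 - q)) ^ m" .
  have prodY: "(\<Prod>j\<in>W. Y j \<omega>) = \<theta> ^ card {j\<in>W. X j \<omega> \<in> A j}" for \<omega>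
    using fin by (simp add: Y_def prod.If_cases Int_def)
  have Yint: "integrable M (\<lambda>\<omega>. \<Prod>j\<in>W. Y j \<omega>)"
    by (rule indep_vars_integrable[OF fin indY intY])
  have "{\<omega>\<in>space M. card W \<le> 2 * card {j\<in>W. X j \<omega> \<in> A j}}
      \<subseteq> {\<omega>\<in>space M. sqrt \<theta> ^ m \<le> (\<Prod>j\<in>W. Y j \<omega>)}"
  proof safe
    fix \<omega> assume le: "card W \<le> 2 * card {j\<in>W. X j \<omega> \<in> A j}"
    have "sqrt \<theta> ^ m \<le> sqrt \<theta> ^ (2 * card {j\<in>W. X j \<omega> \<in> A j})"
      using le \<theta>1 by (intro power_increasing) (auto simp: m_def)
    also have "\<dots> = \<theta> ^ card {j\<in>W. X j \<omega> \<in> A j}"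
      using \<theta>1 by (simp add: power_mult)
    finally show "sqrt \<theta> ^ m \<le> (\<Prod>j\<in>W. Y j \<omega>)" unfolding prodY .
  qed
  then have "prob {\<omega>\<in>space M. card W \<le> 2 * card {j\<in>W. X j \<omega> \<in> A j}}
      \<le> prob {\<omega>\<in>space M. sqrt \<theta> ^ m \<le> (\<Prod>j\<in>W. Y j \<omega>)}"
    using Yint by (intro finite_measure_mono) auto
  also have "\<dots> \<le> expectation (\<lambda>\<omega>. \<Prod>j\<in>W. Y j \<omega>) / sqrt \<theta> ^ m"
    using \<theta>1 Yint by (intro integral_Markov_inequality_measure[where A = "space M"])
       (auto intro!: prod_nonneg AE_I2 simp: Y_def)
  also have "\<dots> \<le> (2 * (1 - q)) ^ m / sqrt \<theta> ^ m"
    using E \<theta>1 by (intro divide_right_mono) auto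
  also have "\<dots> = (2 * (1 - q) / sqrt \<theta>) ^ m"
    by (simp add: power_divide)
  also have "2 * (1 - q) / sqrt \<theta> = sqrt (4 * q * (1 - q))"
    using q by (intro real_sqrt_unique[symmetric])
       (auto simp: \<theta>_def power_divide power_mult_distrib field_simps power2_eq_square)
  finally show ?thesis by (simp add: m_def)
qed

text \<open>For \<open>m\<close> independent fair signs with sum \<open>S\<close>, the expectation of \<open>cos (l S)\<close> is \<open>(cos l)\<^sup>m\<close>,
which for \<open>l = 1 / \<surd>m\<close> is bounded away from \<open>1\<close>. If \<open>\<bar>S\<bar> \<le> \<surd>m / 2\<close> held with probability close to \<open>1\<close>, then
\<open>cos (l S) \<ge> cos (1/2)\<close> would make this expectation too large.\<close>

lemma prob_balanced_count_le:
  fixes X :: "'i \<Rightarrow> 'a \<Rightarrow> real"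
  assumes ind: "indep_vars (\<lambda>_. borel) X W" and fin: "finite W" and ne: "W \<noteq> {}"
    and half: "\<And>j. j \<in> W \<Longrightarrow> prob {\<omega>\<in>space M. 0 < X j \<omega>} = 1/2"
  shows "prob {\<omega>\<in>space M. \<bar>2 * real (card {j\<in>W. 0 < X j \<omega>}) - real (card W)\<bar> \<le> sqrt (card W) / 2} \<le> 24/25"
proof -
  have [simp]: "{\<omega>\<in>space M. P \<omega>} \<inter> space M = {\<omega>\<in>space M. P \<omega>}" for P
    by auto
  define m where "m = card W"
  define l where "l = 1 / sqrt m"
  define s where "s = (\<lambda>j \<omega>. if 0 < X j \<omega> then 1 else - 1 :: real)"
  define S where "S = (\<lambda>\<omega>. \<Sum>j\<in>W. s j \<omega>)"
  have m1: "1 \<le> m" using fin ne by (simp add: m_def Suc_le_eq card_gt_0_iff)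
  have l: "0 < l" "l \<le> 1" using m1 by (auto simp: l_def)
  have rv [measurable]: "random_variable borel (X j)" if "j \<in> W" for j
    using ind that unfolding indep_vars_def by auto
  have sm [measurable]: "random_variable borel (s j)" if "j \<in> W" for j
    using rv[OF that] unfolding s_def by measurable
  have Sm [measurable]: "random_variable borel S"
    unfolding S_def by measurable
  have S_eq: "S \<omega> = 2 * real (card {j\<in>W. 0 < X j \<omega>}) - real m" for \<omega>
  proof -
    have "S \<omega> = (\<Sum>j\<in>W. 2 * (if 0 < X j \<omega> then 1 else 0) - 1)"
      unfolding S_def s_def by (intro sum.cong) auto
    also have "\<dots> = 2 * (\<Sum>j\<in>W. if 0 < X j \<omega> then 1 else 0) - real m"
      by (simp add: sum_subtractf sum_distrib_left m_def)
    also have "(\<Sum>j\<in>W. if 0 < X j \<omega> then 1 else 0 :: real) = card {j\<in>W. 0 < X j \<omega>}"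
      using fin by (simp add: sum.If_cases Int_def)
    finally show ?thesis .
  qed
  have [measurable]: "cis \<in> borel_measurable borel"
    by (intro borel_measurable_continuous_onI continuous_intros)
  have indc: "indep_vars (\<lambda>_. borel) (\<lambda>j \<omega>. cis (l * s j \<omega>)) W"
    unfolding s_def
    by (intro indep_vars_compose2[OF ind, where Y = "\<lambda>j x. cis (l * (if 0 < x then 1 else - 1))"]) auto
  have intc: "integrable M (\<lambda>\<omega>. cis (l * s j \<omega>))" if "j \<in> W" for j
    using that by (intro integrable_const_bound[where B = 1]) auto
  have expc: "expectation (\<lambda>\<omega>. cis (l * s j \<omega>)) = complex_of_real (cos l)" if j: "j \<in> W" for j
  proof -
    have "integrable M (\<lambda>\<omega>. indicator {\<omega>\<in>space M. 0 < X j \<omega>} \<omega> :: real)"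
      using j by (intro integrable_real_indicator) (auto simp: less_top[symmetric])
    then have ind1: "integrable M (\<lambda>\<omega>. complex_of_real (indicator {\<omega>\<in>space M. 0 < X j \<omega>} \<omega>))"
      by simp
    have ind2: "expectation (\<lambda>\<omega>. complex_of_real (indicator {\<omega>\<in>space M. 0 < X j \<omega>} \<omega>))
        = of_real (prob {\<omega>\<in>space M. 0 < X j \<omega>})"
      by (subst integral_complex_of_real) auto
    have "expectation (\<lambda>\<omega>. cis (l * s j \<omega>))
        = expectation (\<lambda>\<omega>. cis (- l) + (cis l - cis (- l)) * of_real (indicator {\<omega>\<in>space M. 0 < X j \<omega>} \<omega>))"
      by (rule Bochner_Integration.integral_cong) (auto simp: s_def)
    also have "\<dots> = cis (- l) + (cis l - cis (- l)) * of_real (prob {\<omega>\<in>space M. 0 < X j \<omega>})"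
      using ind1 ind2 by (subst Bochner_Integration.integral_add) (auto simp: prob_space)
    also have "\<dots> = complex_of_real (cos l)"
      unfolding half[OF j] by (simp add: complex_eq_iff)
    finally show ?thesis .
  qed
  have prodc: "(\<Prod>j\<in>W. cis (l * s j \<omega>)) = cis (l * S \<omega>)" for \<omega>
    unfolding S_def sum_distrib_left using fin by (induction W rule: finite_induct) (auto simp: cis_mult)
  have "expectation (\<lambda>\<omega>. cis (l * S \<omega>)) = (\<Prod>j\<in>W. expectation (\<lambda>\<omega>. cis (l * s j \<omega>)))"
    unfolding prodc[symmetric] by (rule indep_vars_lebesgue_integral[OF fin indc intc])
  also have "\<dots> = complex_of_real (cos l ^ m)"
    using expc by (simp add: m_def)
  finally have Ec: "expectation (\<lambda>\<omega>. cis (l * S \<omega>)) = complex_of_real (cos l ^ m)" .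
  have "integrable M (\<lambda>\<omega>. cis (l * S \<omega>))"
    by (intro integrable_const_bound[where B = 1]) auto
  then have "expectation (\<lambda>\<omega>. Re (cis (l * S \<omega>))) = Re (expectation (\<lambda>\<omega>. cis (l * S \<omega>)))"
    by (rule integral_Re)
  then have Ecos: "expectation (\<lambda>\<omega>. cos (l * S \<omega>)) = cos l ^ m"
    unfolding Ec by simp
  \<comment> \<open>The bounds \<open>4/5\<close> here and \<open>7/8\<close> below give the constant \<open>(1 + 4/5) / (1 + 7/8) = 24/25\<close>.\<close>
  have cosm: "cos l ^ m \<le> 4/5"
  proof -
    obtain t where "cos l = (\<Sum>k<4. cos_coeff k * l ^ k) + cos (t + 1/2 * real (4::nat) * pi) / fact 4 * l ^ 4"
      using Maclaurin_cos_expansion[of l 4] by blast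
    moreover have "{..<4::nat} = {0, 1, 2, 3}" by auto
    then have "(\<Sum>k<4. cos_coeff k * l ^ k) = 1 - l\<^sup>2 / 2"
      by (simp add: cos_coeff_def)
    moreover have "cos (t + 1/2 * real (4::nat) * pi) / fact 4 * l ^ 4 \<le> 1 / fact 4 * l ^ 4"
      by (intro mult_right_mono divide_right_mono) auto
    moreover have "l ^ 4 \<le> l ^ 2"
      using l by (intro power_decreasing) auto
    ultimately have "cos l \<le> 1 - l\<^sup>2 / 2 + 1 / 24 * l\<^sup>2"
      by (simp add: fact_numeral)
    then have "cos l \<le> 1 - l\<^sup>2 / 4"
      using zero_le_power2[of l] by linarith
    also have "\<dots> \<le> exp (- (l\<^sup>2 / 4))"
      using exp_ge_add_one_self[of "- (l\<^sup>2 / 4)"] by simp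
    finally have "cos l ^ m \<le> exp (- (l\<^sup>2 / 4)) ^ m"
      using l cos_ge_zero[of l] pi_gt3 by (intro power_mono) auto
    also have "\<dots> = exp (- (1 / 4))"
      using m1 by (simp add: exp_of_nat_mult[symmetric] l_def power_divide)
    also have "\<dots> = 1 / exp (1/4)"
      by (simp add: exp_minus field_simps)
    also have "\<dots> \<le> 4/5"
      using exp_ge_add_one_self[of "1/4"] by (simp add: field_simps)
    finally show ?thesis .
  qed
  have cosa: "7/8 \<le> cos x" if "\<bar>x\<bar> \<le> 1/2" for x :: real
  proof -
    have "cos x = 1 - 2 * (sin (x/2))\<^sup>2"
      using cos_double_sin[of "x/2"] by simp
    moreover have "\<bar>sin (x/2)\<bar> \<le> \<bar>1/4\<bar>"
      using abs_sin_x_le_abs_x[of "x/2"] that by auto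
    then have "(sin (x/2))\<^sup>2 \<le> (1/4)\<^sup>2"
      by (simp only: abs_le_square_iff)
    ultimately show ?thesis by (simp add: power2_eq_square)
  qed
  let ?E = "{\<omega>\<in>space M. \<bar>S \<omega>\<bar> \<le> sqrt m / 2}"
  have ptw: "15/8 * indicator ?E \<omega> \<le> 1 + cos (l * S \<omega>)" if "\<omega> \<in> space M" for \<omega>
  proof (cases "\<omega> \<in> ?E")
    case True
    then have "\<bar>l * S \<omega>\<bar> \<le> 1/2"
      using m1 by (simp add: l_def abs_mult field_simps)
    then show ?thesis using cosa True by fastforce
  next
    case False
    then have "indicator ?E \<omega> = (0::real)" by (rule indicator_simps(2))
    then show ?thesis using cos_ge_minus_one[of "l * S \<omega>"] by linarith
  qed
  have "15/8 * prob ?E = expectation (\<lambda>\<omega>. 15/8 * indicator ?E \<omega>)"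
    by simp
  also have "\<dots> \<le> expectation (\<lambda>\<omega>. 1 + cos (l * S \<omega>))"
  proof (rule integral_mono[OF _ _ ptw])
    show "integrable M (\<lambda>\<omega>. 15/8 * indicator ?E \<omega> :: real)"
      by (intro integrable_mult_right integrable_real_indicator) (auto simp: less_top[symmetric])
    show "integrable M (\<lambda>\<omega>. 1 + cos (l * S \<omega>))"
      by (intro integrable_const_bound[where B = 2] AE_I2) (auto intro: order_trans[OF abs_triangle_ineq])
  qed
  also have "\<dots> = 1 + cos l ^ m"
    by (subst Bochner_Integration.integral_add)
      (auto simp: Ecos prob_space intro!: integrable_const_bound[where B = 1])
  also have "\<dots> \<le> 9/5" using cosm by simp
  finally have "prob ?E \<le> 24/25" by simp
  then show ?thesis unfolding S_eq by (simp add: m_def)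
qed

section \<open>Mean square error of the median\<close>

lemma nn_integral_square_ge:
  assumes E: "E \<in> events" and t: "0 \<le> t" "\<And>\<omega>. \<omega> \<in> E \<Longrightarrow> t \<le> \<bar>V \<omega>\<bar>" and p: "0 \<le> p" "p \<le> prob E"
  shows "ennreal (t\<^sup>2 * p) \<le> (\<integral>\<^sup>+ \<omega>. ennreal ((V \<omega>)\<^sup>2) \<partial>M)"
proof -
  have "ennreal (t\<^sup>2 * p) \<le> ennreal (t\<^sup>2) * emeasure M E"
    using p by (simp add: ennreal_mult emeasure_eq_measure mult_left_mono ennreal_leI)
  also have "\<dots> = (\<integral>\<^sup>+ \<omega>. ennreal (t\<^sup>2) * indicator E \<omega> \<partial>M)"
    using E by (simp add: nn_integral_cmult_indicator)
  also have "\<dots> \<le> (\<integral>\<^sup>+ \<omega>. ennreal ((V \<omega>)\<^sup>2) \<partial>M)"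
  proof (rule nn_integral_mono)
    fix \<omega>
    have "t\<^sup>2 \<le> (V \<omega>)\<^sup>2" if "\<omega> \<in> E"
      using power_mono[OF t(2)[OF that] t(1), of 2] by simp
    then show "ennreal (t\<^sup>2) * indicator E \<omega> \<le> ennreal ((V \<omega>)\<^sup>2)"
      by (auto simp: indicator_def intro: ennreal_leI)
  qed
  finally show ?thesis .
qed

text \<open>If \<open>\<bar>med\<bar> \<le> t\<close>, then the numbers of positive and of nonpositive values differ by at most twice the
number of values in \<open>[- t, t]\<close>. For \<open>t\<close> a small multiple of \<open>1 / \<surd>m\<close> this number is at most a small
multiple of \<open>\<surd>m\<close> by Markov's inequality, whereas the difference exceeds \<open>\<surd>m / 2\<close> with
positive probability.\<close>

lemma median_mean_square_ge_spread:
  fixes X :: "nat \<Rightarrow> 'a \<Rightarrow> real"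
  assumes ind: "indep_vars (\<lambda>_. borel) X W" and fin: "finite W" and ne: "W \<noteq> {}"
    and half: "\<And>j. j \<in> W \<Longrightarrow> prob {\<omega>\<in>space M. 0 < X j \<omega>} = 1/2"
    and K: "0 < K"
    and conc: "\<And>j t. j \<in> W \<Longrightarrow> 0 \<le> t \<Longrightarrow> prob {\<omega>\<in>space M. \<bar>X j \<omega>\<bar> \<le> t} \<le> K * t"
  shows "ennreal (1 / (2000000 * K\<^sup>2 * card W)) \<le> (\<integral>\<^sup>+ \<omega>. ennreal ((empirical_median W (\<lambda>j. X j \<omega>))\<^sup>2) \<partial>M)"
proof -
  define m where "m = card W"
  \<comment> \<open>The constant 200 makes Markov's bound \<open>1/50\<close>, half of the lower bound \<open>1/25\<close> for the
  probability of an unbalanced count.\<close>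
  define t where "t = 1 / (200 * K * sqrt m)"
  define B where "B = (\<lambda>\<omega>. card {j\<in>W. 0 < X j \<omega>})"
  define C where "C = (\<lambda>\<omega>. card {j\<in>W. \<bar>X j \<omega>\<bar> \<le> t})"
  have m0: "0 < m" using fin ne by (simp add: m_def card_gt_0_iff)
  have t0: "0 \<le> t" using K by (simp add: t_def)
  have rv [measurable]: "random_variable borel (X j)" if "j \<in> W" for j
    using ind that unfolding indep_vars_def by auto
  have [measurable]: "B \<in> measurable M (count_space UNIV)" "C \<in> measurable M (count_space UNIV)"
    unfolding B_def C_def using fin by measurable
  define E1 where "E1 = {\<omega>\<in>space M. \<bar>2 * real (B \<omega>) - real m\<bar> \<le> sqrt m / 2}"
  define E2 where "E2 = {\<omega>\<in>space M. sqrt m / 4 \<le> real (C \<omega>)}"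
  have E_ev: "E1 \<in> events" "E2 \<in> events" unfolding E1_def E2_def by measurable
  have P1: "prob E1 \<le> 24/25"
    using prob_balanced_count_le[OF ind fin ne half] by (simp add: E1_def B_def m_def)
  have C_sum: "real (C \<omega>) = (\<Sum>j\<in>W. indicator {\<omega>\<in>space M. \<bar>X j \<omega>\<bar> \<le> t} \<omega>)" if "\<omega> \<in> space M" for \<omega>
    using fin that by (simp add: C_def indicator_def sum.If_cases Int_def)
  have intI: "integrable M (\<lambda>\<omega>. indicator {\<omega>\<in>space M. \<bar>X j \<omega>\<bar> \<le> t} \<omega> :: real)" if "j \<in> W" for j
    using that by (intro integrable_real_indicator) (auto simp: less_top[symmetric])
  have [simp]: "{\<omega>\<in>space M. P \<omega>} \<inter> space M = {\<omega>\<in>space M. P \<omega>}" for P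
    by auto
  have intC: "integrable M (\<lambda>\<omega>. real (C \<omega>))"
    using intI by (subst Bochner_Integration.integrable_cong[OF refl C_sum]) auto
  have "expectation (\<lambda>\<omega>. real (C \<omega>)) = (\<Sum>j\<in>W. prob {\<omega>\<in>space M. \<bar>X j \<omega>\<bar> \<le> t})"
    using intI by (subst Bochner_Integration.integral_cong[OF refl C_sum]) auto
  also have "\<dots> \<le> (\<Sum>j\<in>W. K * t)"
    using conc t0 by (intro sum_mono) auto
  also have "\<dots> = m * (K * t)" by (simp add: m_def)
  finally have EC: "expectation (\<lambda>\<omega>. real (C \<omega>)) \<le> m * (K * t)" .
  have "prob E2 \<le> expectation (\<lambda>\<omega>. real (C \<omega>)) / (sqrt m / 4)"
    unfolding E2_def using intC m0 by (intro integral_Markov_inequality_measure[where A = "space M"]) auto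
  also have "\<dots> \<le> m * (K * t) / (sqrt m / 4)"
    using EC m0 by (intro divide_right_mono) auto
  also have "\<dots> = 1/50"
    using K m0 by (simp add: t_def field_simps)
  finally have P2: "prob E2 \<le> 1/50" .
  define E where "E = space M - (E1 \<union> E2)"
  have "prob (E1 \<union> E2) \<le> prob E1 + prob E2"
    using E_ev by (intro measure_Un_le)
  then have PE: "1/50 \<le> prob E"
    unfolding E_def using E_ev P1 P2 by (subst prob_compl) auto
  have med: "t \<le> \<bar>empirical_median W (\<lambda>j. X j \<omega>)\<bar>" if "\<omega> \<in> E" for \<omega>
  proof (rule ccontr)
    let ?med = "empirical_median W (\<lambda>j. X j \<omega>)"
    assume "\<not> t \<le> \<bar>?med\<bar>"
    then have le: "?med \<le> t" "- t \<le> ?med" by auto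
    define N where "N = card {j\<in>W. \<not> 0 < X j \<omega>}"
    have "card W \<le> 2 * card {j\<in>W. X j \<omega> \<le> ?med}"
      by (rule empirical_median_splits(1)[OF fin ne])
    also have "card {j\<in>W. X j \<omega> \<le> ?med} \<le> card ({j\<in>W. \<not> 0 < X j \<omega>} \<union> {j\<in>W. \<bar>X j \<omega>\<bar> \<le> t})"
      using le fin by (intro card_mono) auto
    also have "\<dots> \<le> N + C \<omega>"
      unfolding N_def C_def by (rule card_Un_le)
    finally have 1: "m \<le> 2 * (N + C \<omega>)" by (simp add: m_def)
    have "card W \<le> 2 * card {j\<in>W. ?med \<le> X j \<omega>}"
      by (rule empirical_median_splits(2)[OF fin ne])
    also have "card {j\<in>W. ?med \<le> X j \<omega>} \<le> card ({j\<in>W. 0 < X j \<omega>} \<union> {j\<in>W. \<bar>X j \<omega>\<bar> \<le> t})"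
      using le fin by (intro card_mono) auto
    also have "\<dots> \<le> B \<omega> + C \<omega>"
      unfolding B_def C_def by (rule card_Un_le)
    finally have 2: "m \<le> 2 * (B \<omega> + C \<omega>)" by (simp add: m_def)
    have "card ({j\<in>W. \<not> 0 < X j \<omega>} \<union> {j\<in>W. 0 < X j \<omega>}) = N + B \<omega>"
      unfolding N_def B_def using fin by (intro card_Un_disjoint) auto
    moreover have "{j\<in>W. \<not> 0 < X j \<omega>} \<union> {j\<in>W. 0 < X j \<omega>} = W" by auto
    ultimately have 3: "m = N + B \<omega>" by (simp add: m_def)
    have "2 * B \<omega> \<le> m + 2 * C \<omega>" using 1 3 by presburger
    moreover have "m \<le> 2 * B \<omega> + 2 * C \<omega>" using 2 by simp
    ultimately have "real (2 * B \<omega>) \<le> real (m + 2 * C \<omega>)" "real m \<le> real (2 * B \<omega> + 2 * C \<omega>)"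
      by (simp_all only: of_nat_le_iff)
    then have "\<bar>2 * real (B \<omega>) - real m\<bar> \<le> 2 * real (C \<omega>)"
      unfolding abs_le_iff by linarith
    then show False using that by (auto simp: E_def E1_def E2_def)
  qed
  have "ennreal (t\<^sup>2 * (1/50)) \<le> (\<integral>\<^sup>+ \<omega>. ennreal ((empirical_median W (\<lambda>j. X j \<omega>))\<^sup>2) \<partial>M)"
    using E_ev t0 PE med by (intro nn_integral_square_ge[where E = E]) (auto simp: E_def)
  also have "t\<^sup>2 * (1/50) = 1 / (2000000 * K\<^sup>2 * card W)"
    by (simp add: t_def power_divide power_mult_distrib m_def)
  finally show ?thesis .
qed

lemma median_mean_square_ge_bias:
  fixes X :: "nat \<Rightarrow> 'a \<Rightarrow> real" and q :: real
  assumes ind: "indep_vars (\<lambda>_. borel) X W" and fin: "finite W" and ne: "W \<noteq> {}"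
    and q: "0 < q" "q \<le> 1/2" and e: "0 \<le> e"
    and few: "(\<Sum>j\<in>W. prob {\<omega>\<in>space M. X j \<omega> \<le> e}) \<le> card W * q"
  shows "ennreal (e\<^sup>2 * (1 - sqrt (4 * q * (1 - q)) ^ card W))
    \<le> (\<integral>\<^sup>+ \<omega>. ennreal ((empirical_median W (\<lambda>j. X j \<omega>))\<^sup>2) \<partial>M)"
proof -
  have rv [measurable]: "random_variable borel (X j)" if "j \<in> W" for j
    using ind that unfolding indep_vars_def by auto
  define E where "E = {\<omega>\<in>space M. card W \<le> 2 * card {j\<in>W. X j \<omega> \<in> {..e}}}"
  have [measurable]: "E \<in> events"
    unfolding E_def using fin by measurable
  have PE: "prob E \<le> sqrt (4 * q * (1 - q)) ^ card W"
    unfolding E_def by (rule prob_majority_le[OF ind fin _ q]) (use few in auto)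
  have "4 * q * (1 - q) \<le> 1"
    using zero_le_power2[of "2 * q - 1"] by (simp add: power2_eq_square algebra_simps)
  then have le1: "sqrt (4 * q * (1 - q)) ^ card W \<le> 1"
    using q by (intro power_le_one) auto
  have "e \<le> \<bar>empirical_median W (\<lambda>j. X j \<omega>)\<bar>" if \<omega>: "\<omega> \<in> space M - E" for \<omega>
  proof (rule ccontr)
    let ?med = "empirical_median W (\<lambda>j. X j \<omega>)"
    assume "\<not> e \<le> \<bar>?med\<bar>"
    then have "?med \<le> e" by auto
    have "card W \<le> 2 * card {j\<in>W. X j \<omega> \<le> ?med}"
      by (rule empirical_median_splits(1)[OF fin ne])
    also have "card {j\<in>W. X j \<omega> \<le> ?med} \<le> card {j\<in>W. X j \<omega> \<in> {..e}}"
      using \<open>?med \<le> e\<close> fin by (intro card_mono) auto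
    finally show False using \<omega> by (simp add: E_def)
  qed
  then show ?thesis
    using PE le1 e by (intro nn_integral_square_ge[where E = "space M - E"]) (auto simp: prob_compl)
qed

text \<open>Integrating the tail of \<open>V\<^sup>2\<close> by Tonelli's theorem. Measurability is carried by the events \<open>H u\<close>, which
contain the events \<open>u < V\<^sup>2\<close> and in the application are given by counts, whereas \<open>V\<close> is there a function of a
median. Since additivity of the integral is tied to measurability, the affine function of \<open>V\<^sup>2\<close> is
part of the statement.\<close>

lemma second_moment_le_of_tail:
  fixes V :: "'a \<Rightarrow> real" and H :: "real \<Rightarrow> 'a \<Rightarrow> bool"
  assumes [measurable]: "Measurable.pred (lborel \<Otimes>\<^sub>M M) (\<lambda>(u, \<omega>). H u \<omega>)"
    and tail: "\<And>u. 0 \<le> u \<Longrightarrow> prob {\<omega>\<in>space M. H u \<omega>} \<le> 2 * (1 + u) powr (- r)" and r: "1 < r"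
    and H: "\<And>u \<omega>. \<omega> \<in> space M \<Longrightarrow> 0 \<le> u \<Longrightarrow> u < (V \<omega>)\<^sup>2 \<Longrightarrow> H u \<omega>"
    and a: "0 \<le> a" "0 \<le> c"
  shows "(\<integral>\<^sup>+ \<omega>. ennreal (a + c * (V \<omega>)\<^sup>2) \<partial>M) \<le> ennreal (a + c * (2 / (r - 1)))"
proof -
  define G where "G = (\<lambda>\<omega>. \<integral>\<^sup>+ u. indicator {u. 0 \<le> u \<and> H u \<omega>} u \<partial>lborel)"
  have Hm: "(\<lambda>(u, \<omega>). indicator {u. 0 \<le> u \<and> H u \<omega>} u :: ennreal) \<in> borel_measurable (lborel \<Otimes>\<^sub>M M)"
  proof -
    have "Measurable.pred (lborel \<Otimes>\<^sub>M M) (\<lambda>x. 0 \<le> fst x \<and> H (fst x) (snd x))"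
      using assms(1) by (intro pred_intros_logic) (auto simp: case_prod_beta)
    then have "(\<lambda>x. if 0 \<le> fst x \<and> H (fst x) (snd x) then 1 else 0 :: ennreal) \<in> borel_measurable (lborel \<Otimes>\<^sub>M M)"
      by measurable
    then show ?thesis
      by (simp add: indicator_def case_prod_beta)
  qed
  interpret P: pair_sigma_finite lborel M
    by (intro pair_sigma_finite.intro sigma_finite_lborel) unfold_locales
  have Gm [measurable]: "G \<in> borel_measurable M"
    unfolding G_def using measurable_pair_swap[OF Hm]
    by (intro lborel.borel_measurable_nn_integral) (simp add: case_prod_beta)
  have VG: "ennreal ((V \<omega>)\<^sup>2) \<le> G \<omega>" if \<omega>: "\<omega> \<in> space M" for \<omega>
  proof -
    have "ennreal ((V \<omega>)\<^sup>2) = (\<integral>\<^sup>+ u. indicator {0..<(V \<omega>)\<^sup>2} u \<partial>lborel)"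
      by simp
    also have "\<dots> \<le> G \<omega>"
      unfolding G_def using H[OF \<omega>] by (intro nn_integral_mono) (auto simp: indicator_def)
    finally show ?thesis .
  qed
  have "(\<integral>\<^sup>+ \<omega>. G \<omega> \<partial>M) = (\<integral>\<^sup>+ u. (\<integral>\<^sup>+ \<omega>. indicator {u. 0 \<le> u \<and> H u \<omega>} u \<partial>M) \<partial>lborel)"
    unfolding G_def by (rule P.Fubini'[OF Hm])
  also have "\<dots> \<le> (\<integral>\<^sup>+ u. ennreal (2 * (1 + u) powr (- r)) * indicator {0..} u \<partial>lborel)"
  proof (rule nn_integral_mono)
    fix u :: real
    show "(\<integral>\<^sup>+ \<omega>. indicator {u. 0 \<le> u \<and> H u \<omega>} u \<partial>M) \<le> ennreal (2 * (1 + u) powr (- r)) * indicator {0..} u"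
    proof (cases "0 \<le> u")
      case True
      have [measurable]: "Measurable.pred M (H u)"
        using measurable_compose[OF measurable_Pair1'[of u lborel M] assms(1)] by simp
      have "(\<integral>\<^sup>+ \<omega>. indicator {u. 0 \<le> u \<and> H u \<omega>} u \<partial>M) = (\<integral>\<^sup>+ \<omega>. indicator {\<omega>\<in>space M. H u \<omega>} \<omega> \<partial>M)"
        using True by (intro nn_integral_cong) (auto simp: indicator_def)
      also have "\<dots> = ennreal (prob {\<omega>\<in>space M. H u \<omega>})"
        by (subst nn_integral_indicator) (auto simp: emeasure_eq_measure)
      finally show ?thesis using tail[OF True] True by (simp add: ennreal_leI)
    qed (simp add: indicator_def)
  qed
  also have "\<dots> = ennreal (0 - (- (2 / (r - 1)) * (1 + 0) powr (1 - r)))"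
  proof (rule nn_integral_FTC_atLeast)
    fix u :: real assume "0 \<le> u"
    then have "((\<lambda>u. (1 + u) powr (1 - r)) has_real_derivative (1 - r) * (1 + u) powr (- r)) (at u)"
      by (auto intro!: derivative_eq_intros)
    from DERIV_cmult[OF this, of "- (2 / (r - 1))"]
    have "((\<lambda>u. - (2 / (r - 1)) * (1 + u) powr (1 - r)) has_real_derivative
        - (2 / (r - 1)) * ((1 - r) * (1 + u) powr (- r))) (at u)" .
    also have "- (2 / (r - 1)) * ((1 - r) * (1 + u) powr (- r)) = 2 * (1 + u) powr (- r)"
    proof -
      have "- (2 / (r - 1)) * (1 - r) = 2" using r by (simp add: field_simps)
      then show ?thesis by (metis mult.assoc)
    qed
    finally show "((\<lambda>u. - (2 / (r - 1)) * (1 + u) powr (1 - r)) has_real_derivative 2 * (1 + u) powr (- r)) (at u)" .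
  next
    have "((\<lambda>u. (1 + u) powr (1 - r)) \<longlongrightarrow> 0) at_top"
      using r by (intro tendsto_neg_powr filterlim_tendsto_add_at_top[OF tendsto_const filterlim_ident]) auto
    then show "((\<lambda>u. - (2 / (r - 1)) * (1 + u) powr (1 - r)) \<longlongrightarrow> 0) at_top"
      using tendsto_mult_right_zero by blast
  qed auto
  finally have IG: "(\<integral>\<^sup>+ \<omega>. G \<omega> \<partial>M) \<le> ennreal (2 / (r - 1))" by simp
  have "(\<integral>\<^sup>+ \<omega>. ennreal (a + c * (V \<omega>)\<^sup>2) \<partial>M) \<le> (\<integral>\<^sup>+ \<omega>. ennreal a + ennreal c * G \<omega> \<partial>M)"
    using VG a by (intro nn_integral_mono) (auto simp: ennreal_plus ennreal_mult intro!: add_mono mult_left_mono)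
  also have "\<dots> = ennreal a + ennreal c * (\<integral>\<^sup>+ \<omega>. G \<omega> \<partial>M)"
    by (simp add: nn_integral_add nn_integral_cmult emeasure_space_1)
  also have "\<dots> \<le> ennreal a + ennreal c * ennreal (2 / (r - 1))"
    using IG by (intro add_mono mult_left_mono) auto
  also have "\<dots> = ennreal (a + c * (2 / (r - 1)))"
    using a r by (simp add: ennreal_plus ennreal_mult[symmetric])
  finally show ?thesis .
qed

text \<open>If the median of the observations is farther than \<open>b + \<sigma> t\<close> from \<open>g0\<close>, then at least half of the
noise variables lie above \<open>t\<close>, or at least half lie below \<open>- t\<close>. By the tail hypothesis and the majority
bound this has probability at most \<open>2 (1 + t\<^sup>2)\<^sup>-\<^sup>r\<close> with \<open>r = \<kappa> m / 2\<close>.\<close>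

lemma median_mean_square_le:
  fixes Z :: "nat \<Rightarrow> 'a \<Rightarrow> real" and \<kappa> :: real
  assumes ind: "indep_vars (\<lambda>_. borel) Z W" and fin: "finite W" and ne: "W \<noteq> {}"
    and \<kappa>: "0 < \<kappa>" "4 \<le> \<kappa> * card W" and \<sigma>: "0 < \<sigma>"
    and tail: "\<And>t. 0 \<le> t \<Longrightarrow> \<exists>q>0. q \<le> 1/2 \<and> 4 * q * (1 - q) \<le> (1 + t\<^sup>2) powr (- \<kappa>) \<and>
        (\<forall>j\<in>W. prob {\<omega>\<in>space M. t < Z j \<omega>} \<le> q \<and> prob {\<omega>\<in>space M. Z j \<omega> < - t} \<le> q)"
    and g: "\<And>j. j \<in> W \<Longrightarrow> \<bar>g j - g0\<bar> \<le> b"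
  shows "(\<integral>\<^sup>+ \<omega>. ennreal ((empirical_median W (\<lambda>j. g j + \<sigma> * Z j \<omega>) - g0)\<^sup>2) \<partial>M)
    \<le> ennreal (2 * b\<^sup>2 + 16 * \<sigma>\<^sup>2 / (\<kappa> * card W))"
proof -
  define m where "m = card W"
  define r where "r = \<kappa> * m / 2"
  define H where "H = (\<lambda>u \<omega>. m \<le> 2 * card {j\<in>W. Z j \<omega> \<in> {sqrt u<..}} \<or> m \<le> 2 * card {j\<in>W. Z j \<omega> \<in> {..<- sqrt u}})"
  define L where "L = (\<lambda>\<omega>. \<bar>empirical_median W (\<lambda>j. g j + \<sigma> * Z j \<omega>) - g0\<bar>)"
  define V where "V = (\<lambda>\<omega>. max 0 ((L \<omega> - b) / \<sigma>))"
  have rv [measurable]: "random_variable borel (Z j)" if "j \<in> W" for j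
    using ind that unfolding indep_vars_def by auto
  have b0: "0 \<le> b" using g ne by force
  have r2: "2 \<le> r" using \<kappa> by (simp add: r_def m_def)
  have Hm: "Measurable.pred (lborel \<Otimes>\<^sub>M M) (\<lambda>(u, \<omega>). H u \<omega>)"
    unfolding H_def greaterThan_iff lessThan_iff using fin by measurable
  have Htail: "prob {\<omega>\<in>space M. H u \<omega>} \<le> 2 * (1 + u) powr (- r)" if u: "0 \<le> u" for u
  proof -
    obtain q where q: "0 < q" "q \<le> 1/2" "4 * q * (1 - q) \<le> (1 + (sqrt u)\<^sup>2) powr (- \<kappa>)"
      and Pq: "\<And>j. j \<in> W \<Longrightarrow> prob {\<omega>\<in>space M. sqrt u < Z j \<omega>} \<le> q"
        "\<And>j. j \<in> W \<Longrightarrow> prob {\<omega>\<in>space M. Z j \<omega> < - sqrt u} \<le> q"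
      using tail[of "sqrt u"] u by auto
    have [measurable]: "Measurable.pred M (\<lambda>\<omega>. m \<le> 2 * card {j\<in>W. Z j \<omega> \<in> {sqrt u<..}})"
        "Measurable.pred M (\<lambda>\<omega>. m \<le> 2 * card {j\<in>W. Z j \<omega> \<in> {..<- sqrt u}})"
      using fin by measurable
    have "prob {\<omega>\<in>space M. H u \<omega>} = prob ({\<omega>\<in>space M. m \<le> 2 * card {j\<in>W. Z j \<omega> \<in> {sqrt u<..}}}
        \<union> {\<omega>\<in>space M. m \<le> 2 * card {j\<in>W. Z j \<omega> \<in> {..<- sqrt u}}})"
      unfolding H_def by (rule arg_cong[where f = prob]) auto
    also have "\<dots> \<le> prob {\<omega>\<in>space M. m \<le> 2 * card {j\<in>W. Z j \<omega> \<in> {sqrt u<..}}}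
        + prob {\<omega>\<in>space M. m \<le> 2 * card {j\<in>W. Z j \<omega> \<in> {..<- sqrt u}}}"
      by (rule measure_Un_le) measurable
    also have "\<dots> \<le> sqrt (4 * q * (1 - q)) ^ m + sqrt (4 * q * (1 - q)) ^ m"
      unfolding m_def
      by (intro add_mono prob_majority_le[OF ind fin _ q(1,2)])
        (use Pq in \<open>auto intro!: sum_bounded_above\<close>)
    also have "\<dots> \<le> 2 * sqrt ((1 + u) powr (- \<kappa>)) ^ m"
      using q u power_mono[OF real_sqrt_le_mono[OF q(3)], of m] by simp
    also have "sqrt ((1 + u) powr (- \<kappa>)) ^ m = (1 + u) powr (- r)"
      using u by (simp add: r_def powr_half_sqrt[symmetric] powr_powr powr_realpow[symmetric] field_simps)
    finally show ?thesis .
  qed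
  have HV: "H u \<omega>" if \<omega>: "\<omega> \<in> space M" and u: "0 \<le> u" "u < (V \<omega>)\<^sup>2" for u \<omega>
  proof -
    let ?y = "\<lambda>j. g j + \<sigma> * Z j \<omega>"
    let ?med = "empirical_median W ?y"
    have "sqrt u < V \<omega>"
      using u by (intro real_less_lsqrt) (auto simp: V_def)
    moreover have "0 \<le> sqrt u" using u by simp
    ultimately have "sqrt u < (L \<omega> - b) / \<sigma>" unfolding V_def by linarith
    then have "b + \<sigma> * sqrt u < L \<omega>"
      using \<sigma> by (simp add: field_simps)
    then consider "g0 + b + \<sigma> * sqrt u < ?med" | "?med < g0 - b - \<sigma> * sqrt u"
      unfolding L_def by linarith
    then show ?thesis
    proof cases
      case 1
      have "sqrt u < Z j \<omega>" if "j \<in> W" "?med \<le> ?y j" for j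
      proof -
        have "\<sigma> * sqrt u < \<sigma> * Z j \<omega>" using 1 that g[of j] by linarith
        then show ?thesis using \<sigma> by simp
      qed
      then have "card {j\<in>W. ?med \<le> ?y j} \<le> card {j\<in>W. Z j \<omega> \<in> {sqrt u<..}}"
        using fin by (intro card_mono) auto
      then show ?thesis
        using empirical_median_splits(2)[OF fin ne, of ?y] by (simp add: H_def m_def)
    next
      case 2
      have "Z j \<omega> < - sqrt u" if "j \<in> W" "?y j \<le> ?med" for j
      proof -
        have "\<sigma> * Z j \<omega> < \<sigma> * (- sqrt u)" using 2 that g[of j] by (simp add: abs_le_iff)
        then show ?thesis using \<sigma> by (metis mult_less_cancel_left_pos)
      qed
      then have "card {j\<in>W. ?y j \<le> ?med} \<le> card {j\<in>W. Z j \<omega> \<in> {..<- sqrt u}}"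
        using fin by (intro card_mono) auto
      then show ?thesis
        using empirical_median_splits(1)[OF fin ne, of ?y] by (simp add: H_def m_def)
    qed
  qed
  have "(\<integral>\<^sup>+ \<omega>. ennreal ((empirical_median W (\<lambda>j. g j + \<sigma> * Z j \<omega>) - g0)\<^sup>2) \<partial>M)
      \<le> (\<integral>\<^sup>+ \<omega>. ennreal (2 * b\<^sup>2 + 2 * \<sigma>\<^sup>2 * (V \<omega>)\<^sup>2) \<partial>M)"
  proof (intro nn_integral_mono ennreal_leI)
    fix \<omega>
    have "(L \<omega> - b) / \<sigma> \<le> V \<omega>" by (simp add: V_def)
    then have "L \<omega> \<le> b + \<sigma> * V \<omega>" using \<sigma> by (simp add: field_simps)
    then have "(L \<omega>)\<^sup>2 \<le> (b + \<sigma> * V \<omega>)\<^sup>2"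
      by (intro power_mono) (auto simp: L_def)
    also have "\<dots> \<le> 2 * b\<^sup>2 + 2 * \<sigma>\<^sup>2 * (V \<omega>)\<^sup>2"
      using zero_le_power2[of "b - \<sigma> * V \<omega>"] by (simp add: power2_eq_square algebra_simps)
    finally show "(empirical_median W (\<lambda>j. g j + \<sigma> * Z j \<omega>) - g0)\<^sup>2 \<le> 2 * b\<^sup>2 + 2 * \<sigma>\<^sup>2 * (V \<omega>)\<^sup>2"
      by (simp add: L_def)
  qed
  also have "\<dots> \<le> ennreal (2 * b\<^sup>2 + 2 * \<sigma>\<^sup>2 * (2 / (r - 1)))"
    using r2 by (intro second_moment_le_of_tail[OF Hm Htail _ HV]) auto
  also have "\<dots> \<le> ennreal (2 * b\<^sup>2 + 16 * \<sigma>\<^sup>2 / (\<kappa> * card W))"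
  proof (intro ennreal_leI add_left_mono)
    have "2 / (r - 1) \<le> 4 / r" using r2 by (simp add: field_simps)
    then have "2 * \<sigma>\<^sup>2 * (2 / (r - 1)) \<le> 2 * \<sigma>\<^sup>2 * (4 / r)" by (intro mult_left_mono) auto
    then show "2 * \<sigma>\<^sup>2 * (2 / (r - 1)) \<le> 16 * \<sigma>\<^sup>2 / (\<kappa> * card W)"
      by (simp add: r_def m_def)
  qed
  finally show ?thesis .
qed

end

section \<open>Counting design points\<close>

lemma card_nat_interval_le:
  fixes a b :: real
  assumes "a \<le> b + 1"
  shows "real (card {j::nat. a \<le> real j \<and> real j \<le> b}) \<le> b - a + 1"
proof -
  let ?S = "{j::nat. a \<le> real j \<and> real j \<le> b}"
  have "card ?S = card (int ` ?S)"
    by (simp add: card_image)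
  also have "\<dots> \<le> card {\<lceil>a\<rceil>..\<lfloor>b\<rfloor>}"
    by (intro card_mono) (auto simp: ceiling_le_iff le_floor_iff)
  finally have "real (card ?S) \<le> real (nat (\<lfloor>b\<rfloor> - \<lceil>a\<rceil> + 1))" by simp
  also have "\<dots> \<le> b - a + 1"
    using assms by linarith
  finally show ?thesis .
qed

lemma card_nat_interval_ge:
  fixes a b :: real
  assumes "0 \<le> a"
  shows "b - a - 1 \<le> real (card {j::nat. a < real j \<and> real j \<le> b})"
proof (cases "b < 0")
  case False
  have "{nat \<lfloor>a\<rfloor> + 1..nat \<lfloor>b\<rfloor>} \<subseteq> {j. a < real j \<and> real j \<le> b}"
  proof
    fix j assume "j \<in> {nat \<lfloor>a\<rfloor> + 1..nat \<lfloor>b\<rfloor>}"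
    then have "\<lfloor>a\<rfloor> < int j" "int j \<le> \<lfloor>b\<rfloor>" using assms False by auto
    then show "j \<in> {j. a < real j \<and> real j \<le> b}" by (auto simp: floor_less_iff le_floor_iff)
  qed
  moreover have "finite {j::nat. a < real j \<and> real j \<le> b}"
    by (rule finite_subset[of _ "{..nat \<lfloor>b\<rfloor>}"]) (auto simp: le_nat_floor)
  ultimately have "card {nat \<lfloor>a\<rfloor> + 1..nat \<lfloor>b\<rfloor>} \<le> card {j::nat. a < real j \<and> real j \<le> b}"
    by (intro card_mono)
  then have "real (nat \<lfloor>b\<rfloor>) - real (nat \<lfloor>a\<rfloor>) \<le> real (card {j::nat. a < real j \<and> real j \<le> b})"
    by simp
  then show ?thesis using assms False by linarith
qed (use assms in linarith)

lemma window_finite [simp]: "finite (window n h i)"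
  by (simp add: window_def)

lemma window_nonempty:
  assumes "i \<in> {1..n}" "0 < h"
  shows "window n h i \<noteq> {}"
proof -
  have "i \<in> window n h i" using assms by (simp add: window_def)
  then show ?thesis by blast
qed

lemma card_window_le:
  assumes "0 < h"
  shows "real (card (window n h i)) \<le> 2 * (real n * h) + 1"
proof -
  have "finite {j. real i - real n * h \<le> real j \<and> real j \<le> real i + real n * h}"
    by (rule finite_subset[of _ "{..nat \<lfloor>real i + real n * h\<rfloor>}"]) (blast intro: le_nat_floor)+
  then have "card (window n h i) \<le> card {j. real i - real n * h \<le> real j \<and> real j \<le> real i + real n * h}"
    by (rule card_mono) (auto simp: window_def)
  then have "real (card (window n h i)) \<le> real (card {j. real i - real n * h \<le> real j \<and> real j \<le> real i + real n * h})"
    by simp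
  also have "real (card {j. real i - real n * h \<le> real j \<and> real j \<le> real i + real n * h})
      \<le> (real i + real n * h) - (real i - real n * h) + 1"
    using assms by (intro card_nat_interval_le) (simp add: add_increasing)
  finally show ?thesis by (simp add: mult.commute)
qed

text \<open>Near the end points of the design the window is one-sided: for \<open>h \<le> 1/2\<close> one of its two halves is
complete.\<close>

lemma card_window_ge:
  assumes i: "i \<in> {1..n}" and h: "0 < h" "h \<le> 1/2"
  shows "real n * h - 1 \<le> real (card (window n h i))"
proof -
  have nh: "real n * h \<le> real n / 2" "0 \<le> real n * h"
    using h mult_left_mono[of h "1/2" "real n"] by auto
  show ?thesis
  proof (cases "real i \<le> real n / 2")
    case True
    have "(real i + real n * h) - real i - 1 \<le> real (card {j. real i < real j \<and> real j \<le> real i + real n * h})"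
      by (rule card_nat_interval_ge) simp
    also have "\<dots> \<le> real (card (window n h i))"
    proof (intro of_nat_mono card_mono subsetI)
      fix j assume j: "j \<in> {j. real i < real j \<and> real j \<le> real i + real n * h}"
      then have "real j \<le> real n" using nh True by auto
      then show "j \<in> window n h i" using j i by (auto simp: window_def)
    qed simp
    finally show ?thesis by simp
  next
    case False
    have "real i - (real i - real n * h) - 1 \<le> real (card {j. real i - real n * h < real j \<and> real j \<le> real i})"
      using nh False by (intro card_nat_interval_ge) simp
    also have "\<dots> \<le> real (card (window n h i))"
    proof (intro of_nat_mono card_mono subsetI)
      fix j assume j: "j \<in> {j. real i - real n * h < real j \<and> real j \<le> real i}"
      then have "0 < real j" using nh False by auto
      then show "j \<in> window n h i" using j i by (auto simp: window_def)
    qed simp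
    finally show ?thesis by simp
  qed
qed

text \<open>Around a design point at distance at most \<open>d / 2\<close> to the left of \<open>n / 2\<close>, the window reaches at least
\<open>d / 2\<close> beyond \<open>n / 2\<close>, while its size is at most \<open>2 d + 1\<close>; so a fixed fraction of it lies to the right of
the middle. Truncating \<open>h\<close> at \<open>1/2\<close> covers windows that exceed the whole design.\<close>

lemma window_straddles_jump:
  assumes h: "0 < h" and d: "d = real n * min h (1/2)" and d10: "10 \<le> d"
    and i: "i \<in> {1..n}" "real n / 2 - d / 2 < real i" "real i \<le> real n / 2"
  shows "real (card (window n h i)) \<le> 6 * real (card {j\<in>window n h i. real n / 2 < real j})"
    and "d / 2 - 1 \<le> real (card (window n h i))"
proof -
  have dh: "d \<le> real n * h" "d \<le> real n / 2"
    using mult_left_mono[of "min h (1/2)" h "real n"] mult_left_mono[of "min h (1/2)" "1/2" "real n"]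
    by (auto simp: d)
  have "(real n / 2 + d / 2) - real n / 2 - 1 \<le> real (card {j. real n / 2 < real j \<and> real j \<le> real n / 2 + d / 2})"
    by (rule card_nat_interval_ge) simp
  also have "\<dots> \<le> real (card {j\<in>window n h i. real n / 2 < real j})"
  proof (intro of_nat_mono card_mono subsetI)
    fix j assume j: "j \<in> {j. real n / 2 < real j \<and> real j \<le> real n / 2 + d / 2}"
    then have "0 < real j" "real j \<le> real n" "real j - real i \<le> d"
      using dh i by auto
    then have "j \<in> {1..n}" "\<bar>real j - real i\<bar> \<le> real n * h"
      using j i dh by auto
    then show "j \<in> {j\<in>window n h i. real n / 2 < real j}" using j by (simp add: window_def)
  qed simp
  finally have A: "d / 2 - 1 \<le> real (card {j\<in>window n h i. real n / 2 < real j})" by simp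
  also have "\<dots> \<le> real (card (window n h i))"
    by (intro of_nat_mono card_mono) auto
  finally show "d / 2 - 1 \<le> real (card (window n h i))" .
  have "real (card (window n h i)) \<le> 2 * d + 1"
  proof (cases "h \<le> 1/2")
    case True
    then show ?thesis using card_window_le[OF h, of n i] by (simp add: d)
  next
    case False
    have "card (window n h i) \<le> card {1..n}"
      by (intro card_mono) (auto simp: window_def)
    then show ?thesis using False by (simp add: d)
  qed
  also have "\<dots> \<le> 6 * (d / 2 - 1)" using d10 by simp
  also have "\<dots> \<le> 6 * real (card {j\<in>window n h i. real n / 2 < real j})"
    using A by simp
  finally show "real (card (window n h i)) \<le> 6 * real (card {j\<in>window n h i. real n / 2 < real j})" .
qed

section \<open>Piecewise Lipschitz functions\<close>

text \<open>For each \<open>b > \<beta>\<close> the inequality \<open>\<bar>f y - f x\<bar> \<le> b (y - x)\<close> holds for \<open>x \<le> t \<le> y\<close> close to any given \<open>t\<close>,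
and it is additive over adjacent intervals; by bisection it then holds on \<open>[u, v]\<close>.\<close>

lemma local_Lip_le_imp_Lipschitz:
  assumes uv: "u \<le> v" "{u..v} \<subseteq> {0..1}" and L: "\<And>t. t \<in> {u..v} \<Longrightarrow> local_Lip f t \<le> ereal \<beta>"
  shows "\<bar>f v - f u\<bar> \<le> \<beta> * (v - u)"
proof -
  have "\<bar>f v - f u\<bar> \<le> b * (v - u)" if b: "\<beta> < b" for b
  proof -
    have "u \<le> u \<and> v \<le> v \<longrightarrow> \<bar>f v - f u\<bar> \<le> b * (v - u)"
      using uv(1)
    proof (induction rule: Bolzano[where P = "\<lambda>x y. u \<le> x \<and> y \<le> v \<longrightarrow> \<bar>f y - f x\<bar> \<le> b * (y - x)"])
      case (trans x y z)
      have "\<bar>f z - f x\<bar> \<le> b * (z - y) + b * (y - x)" if "u \<le> x" "z \<le> v"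
        using trans that by linarith
      then show ?case by (simp add: algebra_simps)
    next
      case (local t)
      have "local_Lip f t < ereal b"
        using L[of t] local b by (auto intro: le_less_trans)
      then have "eventually (\<lambda>\<epsilon>. (SUP y\<in>{y\<in>{0..1}. \<bar>y - t\<bar> \<le> \<epsilon> \<and> y \<noteq> t}. ereal (\<bar>f y - f t\<bar> / \<bar>y - t\<bar>)) < ereal b) (at_right 0)"
        unfolding local_Lip_def by (rule Limsup_lessD)
      then obtain d where d: "0 < d" and D: "\<And>\<epsilon>. 0 < \<epsilon> \<Longrightarrow> \<epsilon> < d \<Longrightarrow>
          (SUP y\<in>{y\<in>{0..1}. \<bar>y - t\<bar> \<le> \<epsilon> \<and> y \<noteq> t}. ereal (\<bar>f y - f t\<bar> / \<bar>y - t\<bar>)) < ereal b"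
        unfolding eventually_at_right_field by auto
      have near: "\<bar>f y - f t\<bar> \<le> b * \<bar>y - t\<bar>" if y: "y \<in> {u..v}" "\<bar>y - t\<bar> < d" for y
      proof (cases "y = t")
        case False
        have "ereal (\<bar>f y - f t\<bar> / \<bar>y - t\<bar>)
            \<le> (SUP y'\<in>{y'\<in>{0..1}. \<bar>y' - t\<bar> \<le> \<bar>y - t\<bar> \<and> y' \<noteq> t}. ereal (\<bar>f y' - f t\<bar> / \<bar>y' - t\<bar>))"
          using y uv(2) False by (intro SUP_upper) auto
        also have "\<dots> < ereal b"
          using y False by (intro D) auto
        finally show ?thesis using False by (simp add: field_simps)
      qed simp
      show ?case
      proof (intro exI[of _ d] conjI allI impI)
        fix x y assume xy: "x \<le> t \<and> t \<le> y \<and> y - x < d" and uxy: "u \<le> x \<and> y \<le> v"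
        have "\<bar>f x - f t\<bar> \<le> b * (t - x)" "\<bar>f y - f t\<bar> \<le> b * (y - t)"
          using near[of x] near[of y] xy uxy by auto
        then have "\<bar>f y - f x\<bar> \<le> b * (y - t) + b * (t - x)" by linarith
        then show "\<bar>f y - f x\<bar> \<le> b * (y - x)" by (simp add: algebra_simps)
      qed (rule d)
    qed
    then show ?thesis by simp
  qed
  note le = this
  have "((\<lambda>b. b * (v - u)) \<longlongrightarrow> \<beta> * (v - u)) (at_right \<beta>)"
    by (intro tendsto_intros)
  then show ?thesis
    by (rule tendsto_lowerbound) (auto simp: eventually_at_right_field intro!: le exI[of _ "\<beta> + 1"])
qed

lemma local_Lip_le_of_locally_constant:
  assumes d: "0 < d" "\<And>y. y \<in> {0..1} \<Longrightarrow> \<bar>y - t\<bar> < d \<Longrightarrow> f y = f t" and \<beta>: "0 \<le> \<beta>"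
  shows "local_Lip f t \<le> ereal \<beta>"
  unfolding local_Lip_def
proof (rule Limsup_bounded)
  show "eventually (\<lambda>\<epsilon>. (SUP y\<in>{y\<in>{0..1}. \<bar>y - t\<bar> \<le> \<epsilon> \<and> y \<noteq> t}. ereal (\<bar>f y - f t\<bar> / \<bar>y - t\<bar>)) \<le> ereal \<beta>) (at_right 0)"
    unfolding eventually_at_right_field
    using d \<beta> by (intro exI[of _ d]) (auto intro!: SUP_least)
qed

text \<open>The least favourable functions are steps at \<open>1/2\<close>: \<open>c = 1\<close> for wide windows and \<open>c = 0\<close> for narrow
ones. All \<open>N\<close> exceptional points may coincide.\<close>

lemma step_in_PLIP:
  assumes "1 \<le> N" "0 \<le> \<beta>" "c \<in> {0..1}"
  shows "(\<lambda>t. if 1/2 < t then c else 0) \<in> PLIP \<beta> N"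
  unfolding PLIP_def
proof (intro CollectI conjI exI[of _ "\<lambda>_. 1/2"] ballI)
  fix t :: real assume "t \<in> {0..1} - (\<lambda>_. 1/2) ` {1..N}"
  then have "t \<noteq> 1/2" using assms(1) by auto
  then show "local_Lip (\<lambda>t. if 1/2 < t then c else 0) t \<le> ereal \<beta>"
    using assms(2) by (intro local_Lip_le_of_locally_constant[where d = "\<bar>t - 1/2\<bar>"]) auto
next
  show "(\<lambda>_. 1/2 :: real) ` {1..N} \<subseteq> {0<..<1}" by (rule image_subsetI) simp
qed (use assms(3) in \<open>auto simp: Pi_iff\<close>)

text \<open>The form in which membership in the class is used: \<open>f\<close> is Lipschitz between \<open>s\<close> and \<open>t\<close> when every
exceptional point is farther from \<open>t\<close> than \<open>s\<close> is.\<close>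

lemma PLIP_Lipschitz_off_jumps:
  assumes f: "f \<in> PLIP \<beta> N"
  obtains x where "x ` {1..N} \<subseteq> {0<..<1}"
    and "\<And>s t. s \<in> {0..1} \<Longrightarrow> t \<in> {0..1} \<Longrightarrow> (\<And>k. k \<in> {1..N} \<Longrightarrow> \<bar>s - t\<bar> < \<bar>x k - t\<bar>) \<Longrightarrow> \<bar>f s - f t\<bar> \<le> \<beta> * \<bar>s - t\<bar>"
proof -
  obtain x where x: "x ` {1..N} \<subseteq> {0<..<1}" and L: "\<And>t. t \<in> {0..1} - x ` {1..N} \<Longrightarrow> local_Lip f t \<le> ereal \<beta>"
    using f unfolding PLIP_def by blast
  have "\<bar>f s - f t\<bar> \<le> \<beta> * \<bar>s - t\<bar>" if st: "s \<in> {0..1}" "t \<in> {0..1}" and far: "\<And>k. k \<in> {1..N} \<Longrightarrow> \<bar>s - t\<bar> < \<bar>x k - t\<bar>" for s t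
  proof -
    have "\<bar>f (max s t) - f (min s t)\<bar> \<le> \<beta> * (max s t - min s t)"
    proof (rule local_Lip_le_imp_Lipschitz)
      fix r assume r: "r \<in> {min s t..max s t}"
      then have "\<bar>r - t\<bar> \<le> \<bar>s - t\<bar>" by auto
      then have "r \<notin> x ` {1..N}" using far by fastforce
      then show "local_Lip f r \<le> ereal \<beta>" using r st by (intro L) auto
    qed (use st in auto)
    moreover have "max s t - min s t = \<bar>s - t\<bar>" by auto
    moreover have "\<bar>f (max s t) - f (min s t)\<bar> = \<bar>f s - f t\<bar>"
      by (cases "s \<le> t") (simp_all add: abs_minus_commute)
    ultimately show ?thesis by simp
  qed
  then show ?thesis using x that by blast
qed

section \<open>Tails of symmetric unimodal noise\<close>

text \<open>The mode given by unimodality need not be \<open>0\<close>, but one of \<open>\<bar>x\<bar>\<close> and \<open>- \<bar>x\<bar>\<close> lies on the same side of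
it as \<open>0\<close>, and symmetry identifies the values of the density there.\<close>

lemma shape_cond_max_at_0:
  assumes "shape_cond \<Psi> \<psi>"
  shows "\<psi> x \<le> \<psi> 0"
proof -
  obtain m where m: "mono_on {..m} \<psi>" "antimono_on {m..} \<psi>" and sym: "\<And>x. \<psi> (- x) = \<psi> x"
    using assms unfolding shape_cond_def unimodal_def by blast
  have abs: "\<psi> x = \<psi> \<bar>x\<bar>" "\<psi> x = \<psi> (- \<bar>x\<bar>)"
    using sym[of x] by (auto simp: abs_if)
  show ?thesis
  proof (cases "0 \<le> m")
    case True
    then have "\<psi> (- \<bar>x\<bar>) \<le> \<psi> 0"
      by (intro mono_onD[OF m(1)]) auto
    then show ?thesis using abs by simp
  next
    case False
    then have "\<psi> \<bar>x\<bar> \<le> \<psi> 0"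
      using monotone_onD[OF m(2), of 0 "\<bar>x\<bar>"] by auto
    then show ?thesis using abs by simp
  qed
qed

locale symmetric_noise = prob_space \<Psi> for \<Psi> :: "real measure" +
  fixes \<psi> :: "real \<Rightarrow> real"
  assumes shape: "shape_cond \<Psi> \<psi>"
begin

lemma density_eq: "\<Psi> = density lborel (\<lambda>x. ennreal (\<psi> x))"
  and nonneg: "0 \<le> \<psi> x" and cont: "continuous_on UNIV \<psi>" and sym: "\<psi> (- x) = \<psi> x"
  using shape by (auto simp: shape_cond_def)

lemma psi_measurable [measurable]: "\<psi> \<in> borel_measurable borel"
  using cont by (rule borel_measurable_continuous_onI)

lemma sets_noise [measurable_cong, simp]: "sets \<Psi> = sets borel" and space_noise [simp]: "space \<Psi> = UNIV"
  by (subst density_eq, simp)+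

lemma emeasure_noise:
  assumes "A \<in> sets borel"
  shows "emeasure \<Psi> A = (\<integral>\<^sup>+ x. ennreal (\<psi> x) * indicator A x \<partial>lborel)"
  using assms by (subst density_eq) (simp add: emeasure_density)

lemma prob_uminus:
  assumes A [measurable]: "A \<in> sets borel"
  shows "prob (uminus ` A) = prob A"
proof -
  have eq: "uminus ` A = {x. - x \<in> A}" by force
  have [measurable]: "{x::real. - x \<in> A} \<in> sets borel"
    by measurable
  have "emeasure \<Psi> {x. - x \<in> A} = (\<integral>\<^sup>+ x. ennreal (\<psi> x) * indicator {x. - x \<in> A} x \<partial>lborel)"
    by (rule emeasure_noise) measurable
  also have "\<dots> = (\<integral>\<^sup>+ x. ennreal (\<psi> x) * indicator {x. - x \<in> A} x \<partial>distr lborel borel uminus)"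
    by (simp add: lborel_distr_uminus)
  also have "\<dots> = (\<integral>\<^sup>+ x. ennreal (\<psi> x) * indicator A x \<partial>lborel)"
    by (subst nn_integral_distr) (auto simp: sym indicator_def)
  also have "\<dots> = emeasure \<Psi> A" by (rule emeasure_noise[symmetric]) measurable
  finally show ?thesis unfolding eq by (simp add: measure_def)
qed

lemma prob_le_length:
  assumes "a \<le> b"
  shows "prob {a..b} \<le> \<psi> 0 * (b - a)"
proof -
  have "emeasure \<Psi> {a..b} \<le> (\<integral>\<^sup>+ x. ennreal (\<psi> 0) * indicator {a..b} x \<partial>lborel)"
    unfolding emeasure_noise[OF atLeastAtMost_borel]
    using shape_cond_max_at_0[OF shape] by (intro nn_integral_mono mult_right_mono ennreal_leI) auto
  also have "\<dots> = ennreal (\<psi> 0 * (b - a))"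
    using assms nonneg by (simp add: nn_integral_cmult_indicator ennreal_mult)
  finally show ?thesis
    using assms nonneg by (simp add: emeasure_eq_measure)
qed

lemma prob_ge_length:
  assumes c: "0 \<le> c" "\<And>x. a < x \<Longrightarrow> x \<le> b \<Longrightarrow> c \<le> \<psi> x" and ab: "a \<le> b"
  shows "c * (b - a) \<le> prob {a<..b}"
proof -
  have "ennreal (c * (b - a)) = (\<integral>\<^sup>+ x. ennreal c * indicator {a<..b} x \<partial>lborel)"
    using ab c(1) by (simp add: nn_integral_cmult_indicator ennreal_mult)
  also have "\<dots> \<le> emeasure \<Psi> {a<..b}"
    unfolding emeasure_noise[OF greaterThanAtMost_borel]
  proof (rule nn_integral_mono)
    fix x :: real
    show "ennreal c * indicator {a<..b} x \<le> ennreal (\<psi> x) * indicator {a<..b} x"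
      using c(2)[of x] by (cases "x \<in> {a<..b}") (simp_all add: ennreal_leI)
  qed
  finally show ?thesis by (simp add: emeasure_eq_measure)
qed

lemma psi_0_pos: "0 < \<psi> 0"
proof (rule ccontr)
  assume "\<not> 0 < \<psi> 0"
  then have z: "\<psi> x = 0" for x
    using shape_cond_max_at_0[OF shape, of x] nonneg[of x] by linarith
  have "emeasure \<Psi> (space \<Psi>) = 0"
    unfolding space_noise by (subst emeasure_noise) (simp_all add: z)
  then show False using emeasure_space_1 by simp
qed

lemma prob_greater_0: "prob {0<..} = 1/2"
proof -
  have "prob {0..0} \<le> 0"
    using prob_le_length[of 0 0] by simp
  then have "prob {0} = 0"
    using measure_nonneg[of \<Psi> "{0}"] by simp
  moreover have "prob UNIV = prob ({..<0} \<union> {0}) + prob {0<..}"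
  proof -
    have "(UNIV :: real set) = ({..<0} \<union> {0}) \<union> {0<..}" by auto
    moreover have "prob (({..<0} \<union> {0}) \<union> {0<..}) = prob ({..<0} \<union> {0}) + prob {0<..}"
      by (rule finite_measure_Union) auto
    ultimately show ?thesis by metis
  qed
  moreover have "prob ({..<0} \<union> {0}) = prob {..<0} + prob {0}"
    by (rule finite_measure_Union) auto
  moreover have "prob {..<0} = prob {0<..}"
    using prob_uminus[of "{0<..}"] by simp
  ultimately show ?thesis using prob_space by simp
qed

lemma prob_atMost_le:
  assumes "0 \<le> t"
  shows "prob {..t} \<le> 1/2 + \<psi> 0 * t"
proof -
  have "prob {..t} \<le> prob ({..<0} \<union> {0..t})"
    by (intro finite_measure_mono) auto
  also have "\<dots> \<le> prob {..<0} + prob {0..t}"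
    by (intro measure_Un_le) auto
  also have "\<dots> \<le> 1/2 + \<psi> 0 * t"
    using prob_le_length[of 0 t] assms prob_uminus[of "{0<..}"] prob_greater_0 by simp
  finally show ?thesis .
qed

lemma prob_greater_eq:
  assumes "0 \<le> t"
  shows "prob {t<..} = 1/2 - prob {0<..t}"
proof -
  have "{0<..} = {0<..t} \<union> {t<..}"
    using assms by auto
  then have "prob {0<..} = prob ({0<..t} \<union> {t<..})" by (rule arg_cong)
  also have "\<dots> = prob {0<..t} + prob {t<..}"
    by (intro finite_measure_Union) auto
  finally show ?thesis using prob_greater_0 by simp
qed

lemma prob_lessThan_minus: "prob {..<- t} = prob {t<..}"
  using prob_uminus[of "{t<..}"] by simp

text \<open>By continuity the density exceeds \<open>\<psi> 0 / 2\<close> near \<open>0\<close>, so the tail falls below \<open>1/2\<close> at a linear rate.\<close>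

lemma prob_greater_le_linear:
  obtains c t0 where "0 < c" "0 < t0" "\<And>t. 0 \<le> t \<Longrightarrow> prob {t<..} \<le> 1/2 - c * min t t0"
proof -
  have "\<forall>\<^sub>F x in nhds 0. \<psi> 0 / 2 < \<psi> x"
    using cont psi_0_pos continuous_on_eq_continuous_at[of UNIV \<psi>]
    by (intro order_tendstoD(1)[where y = "\<psi> 0"]) (auto simp: isCont_def continuous_at tendsto_at_iff_tendsto_nhds)
  then obtain d where d: "0 < d" "\<And>x. \<bar>x\<bar> < d \<Longrightarrow> \<psi> 0 / 2 < \<psi> x"
    unfolding eventually_nhds_metric by (auto simp: dist_real_def)
  show ?thesis
  proof
    fix t :: real assume t: "0 \<le> t"
    have "\<psi> 0 / 2 * (min t (d/2) - 0) \<le> prob {0<..min t (d/2)}"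
    proof (rule prob_ge_length)
      fix x :: real assume "0 < x" "x \<le> min t (d/2)"
      then show "\<psi> 0 / 2 \<le> \<psi> x" using d(1) by (intro less_imp_le[OF d(2)]) auto
    qed (use t d psi_0_pos in auto)
    also have "\<dots> \<le> prob {0<..t}"
      by (intro finite_measure_mono) auto
    finally show "prob {t<..} \<le> 1/2 - \<psi> 0 / 2 * min t (d/2)"
      using prob_greater_eq[OF t] by simp
  qed (use d psi_0_pos in auto)
qed

text \<open>Some exponent \<open>s > 1\<close> is admissible in the decay condition; the tail inherits the exponent
\<open>s - 1 > 0\<close> by integration.\<close>

lemma prob_greater_le_powr:
  assumes "1 < decay_exponent \<psi>"
  obtains C \<delta> where "0 < C" "0 < \<delta>" "\<And>t. 0 \<le> t \<Longrightarrow> prob {t<..} \<le> C * (1 + t) powr (- \<delta>)"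
proof -
  obtain s where s: "1 < s" and bdd: "bounded (range (\<lambda>x. \<psi> x * (\<bar>x\<bar> + 1) powr s))"
    using assms unfolding decay_exponent_def less_Sup_iff by auto
  obtain K where K: "0 < K" "\<And>x. \<bar>\<psi> x * (\<bar>x\<bar> + 1) powr s\<bar> \<le> K"
    using bdd unfolding bounded_pos by auto
  have psi_le: "\<psi> x \<le> K * (1 + x) powr (- s)" if "0 \<le> x" for x
    using K(2)[of x] that nonneg[of x] by (simp add: powr_minus field_simps)
  show ?thesis
  proof
    fix t :: real assume t: "0 \<le> t"
    have "emeasure \<Psi> {t<..} \<le> (\<integral>\<^sup>+ x. ennreal (K * (1 + x) powr (- s)) * indicator {t..} x \<partial>lborel)"
      unfolding emeasure_noise[OF greaterThan_borel]
      using t psi_le by (intro nn_integral_mono) (auto simp: indicator_def intro!: ennreal_leI)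
    also have "\<dots> = ennreal (0 - (- (K / (s - 1)) * (1 + t) powr (1 - s)))"
    proof (rule nn_integral_FTC_atLeast)
      fix u :: real assume "t \<le> u"
      then have "((\<lambda>u. (1 + u) powr (1 - s)) has_real_derivative (1 - s) * (1 + u) powr (- s)) (at u)"
        using t by (auto intro!: derivative_eq_intros)
      from DERIV_cmult[OF this, of "- (K / (s - 1))"]
      have "((\<lambda>u. - (K / (s - 1)) * (1 + u) powr (1 - s)) has_real_derivative
          - (K / (s - 1)) * ((1 - s) * (1 + u) powr (- s))) (at u)" .
      also have "- (K / (s - 1)) * ((1 - s) * (1 + u) powr (- s)) = K * (1 + u) powr (- s)"
      proof -
        have "- (K / (s - 1)) * (1 - s) = K" using s by (simp add: field_simps)
        then show ?thesis by (metis mult.assoc)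
      qed
      finally show "((\<lambda>u. - (K / (s - 1)) * (1 + u) powr (1 - s)) has_real_derivative K * (1 + u) powr (- s)) (at u)" .
    next
      have "((\<lambda>u. (1 + u) powr (1 - s)) \<longlongrightarrow> 0) at_top"
        using s by (intro tendsto_neg_powr filterlim_tendsto_add_at_top[OF tendsto_const filterlim_ident]) auto
      then show "((\<lambda>u. - (K / (s - 1)) * (1 + u) powr (1 - s)) \<longlongrightarrow> 0) at_top"
        using tendsto_mult_right_zero by blast
    qed (use K in auto)
    finally show "prob {t<..} \<le> K / (s - 1) * (1 + t) powr (- (s - 1))"
      using K s by (simp add: emeasure_eq_measure)
  qed (use K s in auto)
qed

text \<open>With \<open>p\<close> the tail at \<open>t\<close>, \<open>4 p (1 - p) = 1 - 4 (1/2 - p)\<^sup>2\<close>. For small \<open>t\<close> the linear bound on \<open>1/2 - p\<close>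
applies, for large \<open>t\<close> the power decay of \<open>p\<close>; in between the factor stays away from \<open>1\<close>. The exponent
\<open>\<kappa>\<close> is the smallest of those required in the three ranges.\<close>

lemma bernoulli_factor_le:
  assumes "1 < decay_exponent \<psi>"
  obtains \<kappa> where "0 < \<kappa>"
    and "\<And>t. 0 \<le> t \<Longrightarrow> 4 * prob {t<..} * (1 - prob {t<..}) \<le> (1 + t\<^sup>2) powr (- \<kappa>)"
proof -
  obtain c t0 where c: "0 < c" "0 < t0" and lin: "\<And>t. 0 \<le> t \<Longrightarrow> prob {t<..} \<le> 1/2 - c * min t t0"
    using prob_greater_le_linear by blast
  obtain C \<delta> where C: "0 < C" "0 < \<delta>" and pw: "\<And>t. 0 \<le> t \<Longrightarrow> prob {t<..} \<le> C * (1 + t) powr (- \<delta>)"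
    using prob_greater_le_powr[OF assms] by blast
  \<comment> \<open>Beyond \<open>T\<close> half of the exponent \<open>\<delta>\<close> suffices to absorb the factor \<open>4 C\<close>.\<close>
  define T where "T = max 1 ((4 * C) powr (2 / \<delta>))"
  define \<kappa> where "\<kappa> = Min {4 * c\<^sup>2, \<delta> / 4, 4 * (c * t0)\<^sup>2 / ln (1 + T\<^sup>2)}"
  have T1: "1 \<le> T" by (simp add: T_def)
  then have lnT: "0 < ln (1 + T\<^sup>2)" by (intro ln_gt_zero) (auto simp: add_pos_nonneg)
  have \<kappa>0: "0 < \<kappa>" using c C lnT by (simp add: \<kappa>_def)
  have \<kappa>le: "\<kappa> \<le> 4 * c\<^sup>2" "\<kappa> \<le> \<delta> / 4" "\<kappa> * ln (1 + T\<^sup>2) \<le> 4 * (c * t0)\<^sup>2"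
  proof -
    show "\<kappa> \<le> 4 * c\<^sup>2" "\<kappa> \<le> \<delta> / 4" by (auto simp: \<kappa>_def)
    have "\<kappa> \<le> 4 * (c * t0)\<^sup>2 / ln (1 + T\<^sup>2)" by (auto simp: \<kappa>_def)
    then show "\<kappa> * ln (1 + T\<^sup>2) \<le> 4 * (c * t0)\<^sup>2" using lnT by (simp add: field_simps)
  qed
  have "4 * prob {t<..} * (1 - prob {t<..}) \<le> (1 + t\<^sup>2) powr (- \<kappa>)" if t: "0 \<le> t" for t
  proof -
    define p where "p = prob {t<..}"
    have pos: "0 < 1 + t\<^sup>2" by (simp add: add_pos_nonneg)
    have ex: "4 * p * (1 - p) \<le> exp (- (4 * (c * min t t0)\<^sup>2))"
    proof -
      have "c * min t t0 \<le> 1/2 - p" using lin[OF t] by (simp add: p_def)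
      then have "(c * min t t0)\<^sup>2 \<le> (1/2 - p)\<^sup>2" using c t by (intro power_mono) auto
      moreover have "4 * p * (1 - p) = 1 - 4 * (1/2 - p)\<^sup>2" by (simp add: power2_eq_square algebra_simps)
      ultimately have "4 * p * (1 - p) \<le> 1 + - (4 * (c * min t t0)\<^sup>2)" by simp
      also have "\<dots> \<le> exp (- (4 * (c * min t t0)\<^sup>2))" by (rule exp_ge_add_one_self)
      finally show ?thesis .
    qed
    have powr_exp: "(1 + t\<^sup>2) powr (- \<kappa>) = exp (- (\<kappa> * ln (1 + t\<^sup>2)))"
      using pos by (simp add: powr_def)
    consider "t \<le> t0" | "t0 < t" "t \<le> T" | "T < t" by linarith
    then have "4 * p * (1 - p) \<le> (1 + t\<^sup>2) powr (- \<kappa>)"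
    proof cases
      case 1
      have "\<kappa> * ln (1 + t\<^sup>2) \<le> 4 * c\<^sup>2 * t\<^sup>2"
        using \<kappa>le(1) \<kappa>0 by (intro mult_mono ln_add_one_self_le_self) auto
      then have "exp (- (4 * (c * min t t0)\<^sup>2)) \<le> (1 + t\<^sup>2) powr (- \<kappa>)"
        unfolding powr_exp using 1 by (simp add: power_mult_distrib min_def)
      then show ?thesis using ex by linarith
    next
      case 2
      have "ln (1 + t\<^sup>2) \<le> ln (1 + T\<^sup>2)"
        using 2 t pos by (subst ln_le_cancel_iff) (auto simp: add_pos_nonneg intro!: power_mono)
      then have "\<kappa> * ln (1 + t\<^sup>2) \<le> \<kappa> * ln (1 + T\<^sup>2)"
        using \<kappa>0 by (intro mult_left_mono) auto
      also have "\<dots> \<le> 4 * (c * min t t0)\<^sup>2" using \<kappa>le(3) 2 by (simp add: min_def)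
      finally have "exp (- (4 * (c * min t t0)\<^sup>2)) \<le> (1 + t\<^sup>2) powr (- \<kappa>)"
        unfolding powr_exp by simp
      then show ?thesis using ex by linarith
    next
      case 3
      have "4 * p * (1 - p) \<le> 4 * p * 1"
        unfolding p_def by (intro mult_left_mono) auto
      also have "\<dots> \<le> 4 * C * (1 + t) powr (- \<delta>)"
        using pw[OF t] by (simp add: p_def)
      also have "\<dots> \<le> (1 + t) powr (\<delta> / 2) * (1 + t) powr (- \<delta>)"
      proof (intro mult_right_mono)
        have "4 * C = ((4 * C) powr (2 / \<delta>)) powr (\<delta> / 2)"
          using C by (simp add: powr_powr)
        also have "\<dots> \<le> (1 + t) powr (\<delta> / 2)"
          using 3 C by (intro powr_mono2) (auto simp: T_def)
        finally show "4 * C \<le> (1 + t) powr (\<delta> / 2)" .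
      qed simp
      also have "\<dots> = (1 + t) powr (- (\<delta> / 2))"
        by (simp add: powr_add[symmetric])
      also have "\<dots> \<le> (1 + t) powr (- (2 * \<kappa>))"
        using \<kappa>le(2) t by (intro powr_mono) auto
      also have "\<dots> = ((1 + t)\<^sup>2) powr (- \<kappa>)"
        using t by (simp add: powr_powr powr_numeral[symmetric] del: powr_numeral)
      also have "\<dots> \<le> (1 + t\<^sup>2) powr (- \<kappa>)"
        using \<kappa>0 t pos by (intro powr_mono2') (auto simp: power2_sum)
      finally show ?thesis .
    qed
    then show ?thesis by (simp add: p_def)
  qed
  then show ?thesis using \<kappa>0 that by blast
qed

text \<open>The Chernoff bound needs a positive parameter, whereas the tail may vanish if the noise is
bounded; in that case any sufficiently small \<open>q\<close> serves.\<close>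

lemma tail_majorant:
  assumes "1 < decay_exponent \<psi>"
  obtains \<kappa> where "0 < \<kappa>"
    and "\<And>t. 0 \<le> t \<Longrightarrow> \<exists>q>0. q \<le> 1/2 \<and> 4 * q * (1 - q) \<le> (1 + t\<^sup>2) powr (- \<kappa>) \<and> prob {t<..} \<le> q"
proof -
  obtain \<kappa> where \<kappa>: "0 < \<kappa>"
    and le: "\<And>t. 0 \<le> t \<Longrightarrow> 4 * prob {t<..} * (1 - prob {t<..}) \<le> (1 + t\<^sup>2) powr (- \<kappa>)"
    using bernoulli_factor_le[OF assms] by blast
  have "\<exists>q>0. q \<le> 1/2 \<and> 4 * q * (1 - q) \<le> (1 + t\<^sup>2) powr (- \<kappa>) \<and> prob {t<..} \<le> q" if t: "0 \<le> t" for t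
  proof -
    have pos: "0 < (1 + t\<^sup>2) powr (- \<kappa>)"
      by (simp add: add_nonneg_eq_0_iff)
    have le1: "(1 + t\<^sup>2) powr (- \<kappa>) \<le> 1"
      using \<kappa> powr_mono[of "- \<kappa>" 0 "1 + t\<^sup>2"] by (simp add: add_nonneg_eq_0_iff)
    have half: "prob {t<..} \<le> 1/2"
      using prob_greater_eq[OF t] by simp
    show ?thesis
    proof (cases "prob {t<..} = 0")
      case True
      define q where "q = (1 + t\<^sup>2) powr (- \<kappa>) / 4"
      have "4 * q * (1 - q) \<le> 4 * q * 1" using pos by (intro mult_left_mono) (auto simp: q_def)
      then show ?thesis using pos le1 True by (intro exI[of _ q]) (auto simp: q_def)
    next
      case False
      then have "0 < prob {t<..}" by (simp add: zero_less_measure_iff)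
      then show ?thesis using le[OF t] half
        by (intro exI[of _ "prob {t<..}"]) auto
    qed
  qed
  then show ?thesis using \<kappa> that by blast
qed

end

section \<open>Risk of the median filter\<close>

locale noisy_observations = prob_space M for M :: "'a measure" +
  fixes \<Psi> :: "real measure" and \<psi> :: "real \<Rightarrow> real" and Z :: "nat \<Rightarrow> nat \<Rightarrow> 'a \<Rightarrow> real" and \<sigma> :: real
  assumes white: "white_noise M \<Psi> Z" and noise_shape: "shape_cond \<Psi> \<psi>" and \<sigma>_pos: "0 < \<sigma>"
begin

lemma Z_measurable:
  assumes "i \<in> {1..n}"
  shows "random_variable borel (Z n i)"
  using white assms unfolding white_noise_def indep_vars_def by blast

lemma Z_distr: "i \<in> {1..n} \<Longrightarrow> distr M borel (Z n i) = \<Psi>"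
  using white unfolding white_noise_def by blast

sublocale noise: symmetric_noise \<Psi> \<psi>
proof (intro symmetric_noise.intro symmetric_noise_axioms.intro)
  have "prob_space (distr M borel (Z 1 1))"
    by (intro prob_space_distr Z_measurable) simp
  then show "prob_space \<Psi>" using Z_distr[of 1 1] by simp
qed (rule noise_shape)

lemma prob_Z:
  assumes i: "i \<in> {1..n}" and A: "A \<in> sets borel"
  shows "prob {\<omega>\<in>space M. Z n i \<omega> \<in> A} = measure \<Psi> A"
proof -
  have "measure \<Psi> A = measure (distr M borel (Z n i)) A" by (simp add: Z_distr[OF i])
  also have "\<dots> = prob (Z n i -` A \<inter> space M)"
    by (rule measure_distr[OF Z_measurable[OF i] A])
  also have "Z n i -` A \<inter> space M = {\<omega>\<in>space M. Z n i \<omega> \<in> A}" by auto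
  finally show ?thesis by simp
qed

lemma indep_Z:
  assumes "W \<subseteq> {1..n}"
  shows "indep_vars (\<lambda>_. borel) (Z n) W"
proof (rule indep_vars_subset[OF _ assms])
  show "indep_vars (\<lambda>_. borel) (Z n) {1..n}"
    using white unfolding white_noise_def by blast
qed

lemma indep_observations:
  "indep_vars (\<lambda>_. borel) (\<lambda>i \<omega>. observation Z \<sigma> f n \<omega> i) (window n h i)"
proof -
  have "indep_vars (\<lambda>_. borel) (Z n) (window n h i)"
    by (rule indep_Z) (auto simp: window_def)
  then show ?thesis
    unfolding observation_def
    by (rule indep_vars_compose2[where Y = "\<lambda>i z. f (real i / real n) + \<sigma> * z"]) auto
qed

lemma risk_le:
  assumes "\<And>i. i \<in> {1..n} \<Longrightarrow>
      (\<integral>\<^sup>+ \<omega>. ennreal ((T (observation Z \<sigma> f n \<omega>) i - f (real i / real n))\<^sup>2) \<partial>M) \<le> ennreal (c i)"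
    and c: "\<And>i. 0 \<le> c i" and n: "1 \<le> n"
  shows "risk M Z \<sigma> n T f \<le> ennreal ((\<Sum>i\<in>{1..n}. c i) / n)"
proof -
  have "risk M Z \<sigma> n T f \<le> (\<Sum>i\<in>{1..n}. ennreal (c i)) / of_nat n"
    unfolding risk_def using assms(1) by (intro divide_right_mono_ennreal sum_mono)
  also have "\<dots> = ennreal (\<Sum>i\<in>{1..n}. c i) / ennreal (real n)"
    using c by (simp add: sum_ennreal ennreal_of_nat_eq_real_of_nat)
  also have "\<dots> = ennreal ((\<Sum>i\<in>{1..n}. c i) / n)"
    using c n by (intro divide_ennreal sum_nonneg) auto
  finally show ?thesis .
qed

lemma risk_ge:
  fixes c :: real
  assumes "\<And>i. i \<in> I \<Longrightarrow>
      ennreal c \<le> (\<integral>\<^sup>+ \<omega>. ennreal ((T (observation Z \<sigma> f n \<omega>) i - f (real i / real n))\<^sup>2) \<partial>M)"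
    and I: "I \<subseteq> {1..n}" and c: "0 \<le> c" and n: "1 \<le> n"
  shows "ennreal (card I * c / n) \<le> risk M Z \<sigma> n T f"
proof -
  have "ennreal (card I * c / n) = ennreal (card I * c) / ennreal (real n)"
    using c n by (intro divide_ennreal[symmetric]) auto
  also have "\<dots> = (\<Sum>i\<in>I. ennreal c) / of_nat n"
    using c by (simp add: ennreal_mult ennreal_of_nat_eq_real_of_nat)
  also have "\<dots> \<le> (\<Sum>i\<in>I. \<integral>\<^sup>+ \<omega>. ennreal ((T (observation Z \<sigma> f n \<omega>) i - f (real i / real n))\<^sup>2) \<partial>M) / of_nat n"
    using assms(1) by (intro divide_right_mono_ennreal sum_mono)
  also have "\<dots> \<le> risk M Z \<sigma> n T f"
    unfolding risk_def using I by (intro divide_right_mono_ennreal sum_mono2) auto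
  finally show ?thesis .
qed

text \<open>For \<open>h \<le> n\<^sup>-\<^sup>1\<^sup>/\<^sup>2\<close> every window has at most \<open>3 \<surd>n\<close> elements, so that already the random
fluctuation of the median costs order \<open>n\<^sup>-\<^sup>1\<^sup>/\<^sup>2\<close> at each design point.\<close>

lemma risk_zero_ge:
  obtains c where "0 < c"
    and "\<And>n h. 1 \<le> n \<Longrightarrow> 0 < h \<Longrightarrow> h \<le> 1 / sqrt n \<Longrightarrow>
      ennreal (c / sqrt n) \<le> risk M Z \<sigma> n (median_filter n h) (\<lambda>_. 0)"
proof
  define K where "K = 2 * \<psi> 0 / \<sigma>"
  have K: "0 < K" using noise.psi_0_pos \<sigma>_pos by (simp add: K_def)
  show "0 < 1 / (6000000 * K\<^sup>2)" using K by simp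
  fix n :: nat and h :: real assume n: "1 \<le> n" and h: "0 < h" "h \<le> 1 / sqrt n"
  have sq: "1 \<le> sqrt n" using n by simp
  have "ennreal (card {1..n} * (1 / (6000000 * K\<^sup>2) / sqrt n) / n) \<le> risk M Z \<sigma> n (median_filter n h) (\<lambda>_. 0)"
  proof (rule risk_ge)
    fix i assume i: "i \<in> {1..n}"
    define W where "W = window n h i"
    have W: "finite W" "W \<noteq> {}" "W \<subseteq> {1..n}"
      using window_nonempty[OF i h(1)] by (auto simp: W_def window_def)
    have "real n * h \<le> real n * (1 / sqrt n)" using h by (intro mult_left_mono) auto
    then have "real n * h \<le> sqrt n" by (simp add: real_div_sqrt)
    then have cW: "real (card W) \<le> 3 * sqrt n"
      unfolding W_def using card_window_le[OF h(1), of n i] sq by linarith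
    have "ennreal (1 / (6000000 * K\<^sup>2) / sqrt n) \<le> ennreal (1 / (2000000 * K\<^sup>2 * card W))"
    proof (rule ennreal_leI)
      have "2000000 * K\<^sup>2 * card W \<le> 2000000 * K\<^sup>2 * (3 * sqrt n)"
        using cW by (intro mult_left_mono) auto
      then have "1 / (2000000 * K\<^sup>2 * (3 * sqrt n)) \<le> 1 / (2000000 * K\<^sup>2 * card W)"
        using K W by (intro divide_left_mono) (auto simp: card_gt_0_iff intro!: mult_pos_pos)
      then show "1 / (6000000 * K\<^sup>2) / sqrt n \<le> 1 / (2000000 * K\<^sup>2 * card W)" by simp
    qed
    also have "\<dots> \<le> (\<integral>\<^sup>+ \<omega>. ennreal ((empirical_median W (\<lambda>j. observation Z \<sigma> (\<lambda>_. 0) n \<omega> j))\<^sup>2) \<partial>M)"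
    proof (rule median_mean_square_ge_spread)
      show "indep_vars (\<lambda>_. borel) (\<lambda>j \<omega>. observation Z \<sigma> (\<lambda>_. 0) n \<omega> j) W"
        unfolding W_def by (rule indep_observations)
    next
      fix j assume "j \<in> W"
      then have j: "j \<in> {1..n}" using W by auto
      have "{\<omega>\<in>space M. 0 < observation Z \<sigma> (\<lambda>_. 0) n \<omega> j} = {\<omega>\<in>space M. Z n j \<omega> \<in> {0<..}}"
        using \<sigma>_pos by (auto simp: observation_def zero_less_mult_iff)
      then show "prob {\<omega>\<in>space M. 0 < observation Z \<sigma> (\<lambda>_. 0) n \<omega> j} = 1/2"
        using prob_Z[OF j, of "{0<..}"] noise.prob_greater_0 by simp
      fix t :: real assume t: "0 \<le> t"
      have level: "\<bar>\<sigma> * z\<bar> \<le> t \<longleftrightarrow> z \<in> {- (t / \<sigma>)..t / \<sigma>}" for z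
      proof -
        have "\<bar>\<sigma> * z\<bar> \<le> t \<longleftrightarrow> \<bar>z\<bar> \<le> t / \<sigma>"
          using \<sigma>_pos by (simp add: abs_mult pos_le_divide_eq mult.commute)
        also have "\<dots> \<longleftrightarrow> z \<in> {- (t / \<sigma>)..t / \<sigma>}"
          unfolding atLeastAtMost_iff by linarith
        finally show ?thesis .
      qed
      have "{\<omega>\<in>space M. \<bar>observation Z \<sigma> (\<lambda>_. 0) n \<omega> j\<bar> \<le> t} = {\<omega>\<in>space M. Z n j \<omega> \<in> {- (t / \<sigma>)..t / \<sigma>}}"
        unfolding observation_def add_0_left level ..
      then have "prob {\<omega>\<in>space M. \<bar>observation Z \<sigma> (\<lambda>_. 0) n \<omega> j\<bar> \<le> t} = noise.prob {- (t / \<sigma>)..t / \<sigma>}"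
        using prob_Z[OF j, of "{- (t / \<sigma>)..t / \<sigma>}"] by simp
      also have "\<dots> \<le> \<psi> 0 * (t / \<sigma> - - (t / \<sigma>))"
        using t \<sigma>_pos by (intro noise.prob_le_length) (simp add: minus_le_iff[of "t / \<sigma>"])
      also have "\<dots> = K * t" by (simp add: K_def)
      finally show "prob {\<omega>\<in>space M. \<bar>observation Z \<sigma> (\<lambda>_. 0) n \<omega> j\<bar> \<le> t} \<le> K * t" .
    qed (use W K in auto)
    finally show "ennreal (1 / (6000000 * K\<^sup>2) / sqrt n)
        \<le> (\<integral>\<^sup>+ \<omega>. ennreal ((median_filter n h (observation Z \<sigma> (\<lambda>_. 0) n \<omega>) i - 0)\<^sup>2) \<partial>M)"
      by (simp add: median_filter_def W_def)
  qed (use n in auto)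
  then show "ennreal (1 / (6000000 * K\<^sup>2) / sqrt n) \<le> risk M Z \<sigma> n (median_filter n h) (\<lambda>_. 0)"
    using n by simp
qed

text \<open>For \<open>h \<ge> n\<^sup>-\<^sup>1\<^sup>/\<^sup>2\<close> and large \<open>n\<close> there are at least \<open>\<surd>n / 4\<close> design points just to the left of the jump whose
windows have at least a sixth of their points to its right. At these the median exceeds a fixed level \<open>e\<close>
with probability at least \<open>1/2\<close>, although the true value is \<open>0\<close>.\<close>

lemma risk_step_ge:
  obtains c n0 where "0 < c"
    and "\<And>n h. n0 \<le> n \<Longrightarrow> 1 / sqrt n \<le> h \<Longrightarrow>
      ennreal (c / sqrt n) \<le> risk M Z \<sigma> n (median_filter n h) (\<lambda>t. if 1/2 < t then 1 else 0)"
proof -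
  let ?f = "\<lambda>t :: real. if 1/2 < t then 1 else 0 :: real"
  define t1 where "t1 = 1 / (4 * \<sigma>)"
  have t1: "0 < t1" using \<sigma>_pos by (simp add: t1_def)
  obtain c0 t0 where c0: "0 < c0" "0 < t0" and lin: "\<And>t. 0 \<le> t \<Longrightarrow> noise.prob {t<..} \<le> 1/2 - c0 * min t t0"
    using noise.prob_greater_le_linear by blast
  define D where "D = c0 * min t1 t0"
  have D: "0 < D" using c0 t1 by (simp add: D_def)
  have Dt: "noise.prob {t1<..} \<le> 1/2 - D" using lin[of t1] t1 by (simp add: D_def)
  then have D2: "D \<le> 1/2" using measure_nonneg[of \<Psi> "{t1<..}"] by linarith
  \<comment> \<open>Beyond the jump an observation falls below \<open>e\<close> with probability at most \<open>1/2 - D\<close>. The level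
    is so low that before the jump the excess over \<open>1/2\<close> is at most \<open>D / 12\<close>, half of the average
    gain \<open>D / 6\<close> from the points beyond.\<close>
  define e where "e = min (1/2) (D * \<sigma> / (12 * \<psi> 0))"
  have e: "0 < e" "e \<le> 1/2" "\<psi> 0 * (e / \<sigma>) \<le> D / 12"
  proof -
    show "0 < e" "e \<le> 1/2" using D \<sigma>_pos noise.psi_0_pos by (auto simp: e_def)
    have "e \<le> D * \<sigma> / (12 * \<psi> 0)" by (simp add: e_def)
    then show "\<psi> 0 * (e / \<sigma>) \<le> D / 12" using \<sigma>_pos noise.psi_0_pos by (simp add: field_simps)
  qed
  define q where "q = 1/2 - D / 12"
  have q: "0 < q" "q < 1/2" using D D2 by (auto simp: q_def)
  define \<rho> where "\<rho> = sqrt (4 * q * (1 - q))"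
  have "4 * q * (1 - q) = 1 - (1 - 2 * q)\<^sup>2" by (simp add: power2_eq_square algebra_simps)
  then have "4 * q * (1 - q) < 1" using q by simp
  then have \<rho>: "0 \<le> \<rho>" "\<rho> < 1" using q by (auto simp: \<rho>_def)
  obtain m0 where m0: "\<rho> ^ m0 < 1/2"
    using real_arch_pow_inv[of "1/2" \<rho>] \<rho> by auto
  define n0 where "n0 = nat \<lceil>(real (2 * m0 + 10))\<^sup>2\<rceil>"
  show ?thesis
  proof
    show "0 < e\<^sup>2 / 8" using e by simp
    fix n :: nat and h :: real assume "n0 \<le> n" and h: "1 / sqrt n \<le> h"
    then have "(real (2 * m0 + 10))\<^sup>2 \<le> real n"
      unfolding n0_def by linarith
    then have sq: "real (2 * m0 + 10) \<le> sqrt n"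
      by (rule real_le_rsqrt)
    then have sq10: "10 \<le> sqrt n" by simp
    then have n1: "1 \<le> n" by (cases n) auto
    have "0 < sqrt n" using sq10 by linarith
    then have h0: "0 < h" by (intro less_le_trans[OF _ h]) simp
    define d where "d = real n * min h (1/2)"
    have "1 / sqrt n \<le> 1 / 10" using sq10 by (intro frac_le) auto
    then have "1 / sqrt n \<le> min h (1/2)" using h by simp
    then have "real n * (1 / sqrt n) \<le> d" unfolding d_def by (intro mult_left_mono) auto
    then have d: "sqrt n \<le> d" by (simp add: real_div_sqrt)
    have dn: "d \<le> real n / 2"
      using mult_left_mono[of "min h (1/2)" "1/2" "real n"] by (simp add: d_def)
    define I where "I = {i. real n / 2 - d / 2 < real i \<and> real i \<le> real n / 2}"
    have I: "I \<subseteq> {1..n}"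
    proof
      fix i assume i: "i \<in> I"
      then have "0 < real i" "real i \<le> real n" using dn by (auto simp: I_def)
      then show "i \<in> {1..n}" by simp
    qed
    have "real n / 2 - (real n / 2 - d / 2) - 1 \<le> real (card I)"
      unfolding I_def using dn by (intro card_nat_interval_ge) simp
    then have cI: "sqrt n / 4 \<le> real (card I)" using d sq10 by simp
    have "ennreal (card I * (e\<^sup>2 / 2) / n) \<le> risk M Z \<sigma> n (median_filter n h) ?f"
    proof (rule risk_ge[OF _ I])
      fix i assume iI: "i \<in> I"
      then have i: "i \<in> {1..n}" "real n / 2 - d / 2 < real i" "real i \<le> real n / 2"
        using I by (auto simp: I_def)
      define W where "W = window n h i"
      define A where "A = {j\<in>W. real n / 2 < real j}"
      have W: "finite W" "W \<noteq> {}" "W \<subseteq> {1..n}"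
        using window_nonempty[OF i(1) h0] by (auto simp: W_def window_def)
      have WA: "real (card W) \<le> 6 * real (card A)" and Wd: "d / 2 - 1 \<le> real (card W)"
        using window_straddles_jump[OF h0 d_def _ i] d sq10 by (auto simp: A_def W_def)
      have "real m0 \<le> real (card W)" using Wd d sq by simp
      then have "\<rho> ^ card W \<le> \<rho> ^ m0" using \<rho> by (intro power_decreasing) auto
      then have \<rho>W: "\<rho> ^ card W \<le> 1/2" using m0 by simp
      have p: "prob {\<omega>\<in>space M. observation Z \<sigma> ?f n \<omega> j \<le> e} \<le> 1/2 + D / 12 - (if j \<in> A then D else 0)"
        if "j \<in> W" for j
      proof -
        have j: "j \<in> {1..n}" using W that by auto
        have jA: "1/2 < real j / real n \<longleftrightarrow> j \<in> A"
          using that n1 by (auto simp: A_def field_simps)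
        show ?thesis
        proof (cases "j \<in> A")
          case True
          have "prob {\<omega>\<in>space M. observation Z \<sigma> ?f n \<omega> j \<le> e} \<le> prob {\<omega>\<in>space M. Z n j \<omega> \<in> {..<- t1}}"
          proof (rule finite_measure_mono)
            have "z < - t1" if "1 + \<sigma> * z \<le> e" for z
            proof -
              have "\<sigma> * t1 = 1/4" using \<sigma>_pos by (simp add: t1_def)
              then have "\<sigma> * z < \<sigma> * (- t1)" using that e(2) by simp
              then show ?thesis using \<sigma>_pos by (metis mult_less_cancel_left_pos)
            qed
            then show "{\<omega>\<in>space M. observation Z \<sigma> ?f n \<omega> j \<le> e} \<subseteq> {\<omega>\<in>space M. Z n j \<omega> \<in> {..<- t1}}"
              using True jA by (auto simp: observation_def)
            show "{\<omega>\<in>space M. Z n j \<omega> \<in> {..<- t1}} \<in> events"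
              using Z_measurable[OF j] by measurable
          qed
          also have "\<dots> = noise.prob {t1<..}"
            using prob_Z[OF j, of "{..<- t1}"] noise.prob_lessThan_minus by simp
          finally show ?thesis using Dt True D by simp
        next
          case False
          have "{\<omega>\<in>space M. observation Z \<sigma> ?f n \<omega> j \<le> e} = {\<omega>\<in>space M. Z n j \<omega> \<in> {..e / \<sigma>}}"
            using False jA \<sigma>_pos by (auto simp: observation_def field_simps)
          then have "prob {\<omega>\<in>space M. observation Z \<sigma> ?f n \<omega> j \<le> e} = noise.prob {..e / \<sigma>}"
            using prob_Z[OF j, of "{..e / \<sigma>}"] by simp
          also have "\<dots> \<le> 1/2 + \<psi> 0 * (e / \<sigma>)"
            using e \<sigma>_pos by (intro noise.prob_atMost_le) auto
          finally have "prob {\<omega>\<in>space M. observation Z \<sigma> ?f n \<omega> j \<le> e} \<le> 1/2 + D / 12"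
            using e(3) by linarith
          then show ?thesis using False by simp
        qed
      qed
      have "(\<Sum>j\<in>W. prob {\<omega>\<in>space M. observation Z \<sigma> ?f n \<omega> j \<le> e})
          \<le> (\<Sum>j\<in>W. 1/2 + D / 12 - (if j \<in> A then D else 0))"
        using p by (rule sum_mono)
      also have "\<dots> = card W * (1/2 + D / 12) - card A * D"
      proof -
        have "W \<inter> {j. j \<in> A} = A" by (auto simp: A_def)
        then show ?thesis using W by (simp add: sum_subtractf sum.If_cases)
      qed
      also have "\<dots> \<le> card W * q"
      proof -
        have "card W * D \<le> 6 * card A * D" using WA D by (intro mult_right_mono) auto
        then have "card W * D / 6 \<le> card A * D"
          by simp
        then show ?thesis by (simp add: q_def algebra_simps)
      qed
      finally have few: "(\<Sum>j\<in>W. prob {\<omega>\<in>space M. observation Z \<sigma> ?f n \<omega> j \<le> e}) \<le> card W * q" .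
      have "ennreal (e\<^sup>2 / 2) \<le> ennreal (e\<^sup>2 * (1 - sqrt (4 * q * (1 - q)) ^ card W))"
        using \<rho>W mult_left_mono[of "1/2" "1 - \<rho> ^ card W" "e\<^sup>2"] unfolding \<rho>_def
        by (intro ennreal_leI) simp
      also have "\<dots> \<le> (\<integral>\<^sup>+ \<omega>. ennreal ((empirical_median W (\<lambda>j. observation Z \<sigma> ?f n \<omega> j))\<^sup>2) \<partial>M)"
        using W q e few
        by (intro median_mean_square_ge_bias) (auto simp: W_def intro!: indep_observations)
      also have "\<dots> = (\<integral>\<^sup>+ \<omega>. ennreal ((median_filter n h (observation Z \<sigma> ?f n \<omega>) i - ?f (real i / real n))\<^sup>2) \<partial>M)"
        using i n1 by (simp add: median_filter_def W_def field_simps)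
      finally show "ennreal (e\<^sup>2 / 2)
          \<le> (\<integral>\<^sup>+ \<omega>. ennreal ((median_filter n h (observation Z \<sigma> ?f n \<omega>) i - ?f (real i / real n))\<^sup>2) \<partial>M)" .
    qed (use n1 in auto)
    moreover have "e\<^sup>2 / 8 / sqrt n \<le> card I * (e\<^sup>2 / 2) / n"
    proof -
      have "e\<^sup>2 / 8 / sqrt n = sqrt n / 4 * (e\<^sup>2 / 2) / n"
        using n1 by (simp add: field_simps)
      also have "\<dots> \<le> card I * (e\<^sup>2 / 2) / n"
        using cI by (intro divide_right_mono mult_right_mono) auto
      finally show ?thesis .
    qed
    ultimately show "ennreal (e\<^sup>2 / 8 / sqrt n) \<le> risk M Z \<sigma> n (median_filter n h) ?f"
      using ennreal_leI order_trans by blast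
  qed
qed

text \<open>At \<open>h = n\<^sup>-\<^sup>1\<^sup>/\<^sup>2\<close>, for large \<open>n\<close>, all windows have at least \<open>\<surd>n / 2\<close> elements, so the noise contributes order
\<open>n\<^sup>-\<^sup>1\<^sup>/\<^sup>2\<close> everywhere. The bias is at most \<open>\<beta> h\<close> at points farther than \<open>h\<close> from the jumps. At the
remaining points, at most \<open>3 N \<surd>n\<close> in number, it is at most \<open>1\<close> since \<open>f\<close> takes values in \<open>[0, 1]\<close>.\<close>

lemma risk_PLIP_le:
  assumes decay: "1 < decay_exponent \<psi>" and \<beta>: "0 \<le> \<beta>"
  obtains C n0 where "0 < C"
    and "\<And>n f. n0 \<le> n \<Longrightarrow> f \<in> PLIP \<beta> N \<Longrightarrow>
      risk M Z \<sigma> n (median_filter n (1 / sqrt n)) f \<le> ennreal (C / sqrt n)"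
proof -
  obtain \<kappa> where \<kappa>: "0 < \<kappa>"
    and tail: "\<And>t. 0 \<le> t \<Longrightarrow> \<exists>q>0. q \<le> 1/2 \<and> 4 * q * (1 - q) \<le> (1 + t\<^sup>2) powr (- \<kappa>) \<and> noise.prob {t<..} \<le> q"
    using noise.tail_majorant[OF decay] by blast
  define n0 where "n0 = nat \<lceil>(8 / \<kappa> + 2)\<^sup>2\<rceil>"
  define a where "a = 2 * \<beta>\<^sup>2 + 32 * \<sigma>\<^sup>2 / \<kappa>"
  have a: "0 < a" unfolding a_def using \<sigma>_pos \<kappa> by (intro add_nonneg_pos) auto
  show ?thesis
  proof
    show "0 < a + 6 * real N" using a by simp
    fix n f assume "n0 \<le> n" and f: "f \<in> PLIP \<beta> N"
    then have "(8 / \<kappa> + 2)\<^sup>2 \<le> real n" unfolding n0_def by linarith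
    then have "8 / \<kappa> + 2 \<le> sqrt n" by (rule real_le_rsqrt)
    moreover have "0 < 8 / \<kappa>" using \<kappa> by simp
    ultimately have sq: "2 \<le> sqrt n" "8 / \<kappa> \<le> sqrt n" by linarith+
    then have n1: "1 \<le> n" by (cases n) auto
    define h where "h = 1 / sqrt n"
    have h: "0 < h" "h \<le> 1/2" "real n * h = sqrt n" "h \<le> 1"
      using sq n1 by (auto simp: h_def field_simps)
    obtain x where x: "x ` {1..N} \<subseteq> {0<..<1}"
      and Lip: "\<And>s t. s \<in> {0..1} \<Longrightarrow> t \<in> {0..1} \<Longrightarrow> (\<And>k. k \<in> {1..N} \<Longrightarrow> \<bar>s - t\<bar> < \<bar>x k - t\<bar>) \<Longrightarrow> \<bar>f s - f t\<bar> \<le> \<beta> * \<bar>s - t\<bar>"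
      using PLIP_Lipschitz_off_jumps[OF f] by blast
    have f01: "f t \<in> {0..1}" if "t \<in> {0..1}" for t
      using f that by (auto simp: PLIP_def)
    define S where "S = (\<Union>k\<in>{1..N}. {i\<in>{1..n}. \<bar>x k - real i / real n\<bar> \<le> h})"
    define b where "b = (\<lambda>i. if i \<in> S then 1 else \<beta> * h)"
    have S: "finite S" "S \<subseteq> {1..n}" by (auto simp: S_def)
    have "card S \<le> (\<Sum>k\<in>{1..N}. card {i\<in>{1..n}. \<bar>x k - real i / real n\<bar> \<le> h})"
      unfolding S_def by (rule card_UN_le) simp
    also have "real \<dots> \<le> (\<Sum>k\<in>{1..N}. 3 * sqrt n)"
      unfolding of_nat_sum
    proof (rule sum_mono)
      fix k
      let ?J = "{i. real n * x k - sqrt n \<le> real i \<and> real i \<le> real n * x k + sqrt n}"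
      have "finite ?J"
        by (rule finite_subset[of _ "{..nat \<lfloor>real n * x k + sqrt n\<rfloor>}"]) (blast intro: le_nat_floor)+
      moreover have "{i\<in>{1..n}. \<bar>x k - real i / real n\<bar> \<le> h} \<subseteq> ?J"
      proof
        fix i assume "i \<in> {i\<in>{1..n}. \<bar>x k - real i / real n\<bar> \<le> h}"
        then have "real n * \<bar>x k - real i / real n\<bar> \<le> real n * h"
          by (intro mult_left_mono) auto
        also have "real n * \<bar>x k - real i / real n\<bar> = \<bar>real n * (x k - real i / real n)\<bar>"
          by (simp add: abs_mult)
        also have "\<dots> = \<bar>real n * x k - real i\<bar>"
          using n1 by (simp add: right_diff_distrib)
        finally show "i \<in> ?J" using h(3) by auto
      qed
      ultimately have "card {i\<in>{1..n}. \<bar>x k - real i / real n\<bar> \<le> h} \<le> card ?J"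
        by (rule card_mono)
      then have "real (card {i\<in>{1..n}. \<bar>x k - real i / real n\<bar> \<le> h}) \<le> real (card ?J)" by simp
      also have "\<dots> \<le> (real n * x k + sqrt n) - (real n * x k - sqrt n) + 1"
        using sq by (intro card_nat_interval_le) linarith
      finally show "real (card {i\<in>{1..n}. \<bar>x k - real i / real n\<bar> \<le> h}) \<le> 3 * sqrt n"
        using sq by linarith
    qed
    finally have cS: "real (card S) \<le> 3 * real N * sqrt n" by simp
    have "risk M Z \<sigma> n (median_filter n h) f
        \<le> ennreal ((\<Sum>i\<in>{1..n}. 2 * (b i)\<^sup>2 + 32 * \<sigma>\<^sup>2 / (\<kappa> * sqrt n)) / n)"
    proof (rule risk_le[OF _ _ n1])
      fix i assume i: "i \<in> {1..n}"
      define W where "W = window n h i"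
      have W: "finite W" "W \<noteq> {}" "W \<subseteq> {1..n}"
        using window_nonempty[OF i h(1)] by (auto simp: W_def window_def)
      have mW: "sqrt n / 2 \<le> real (card W)"
        using card_window_ge[OF i h(1,2)] h(3) sq by (simp add: W_def)
      have "4 \<le> \<kappa> * (sqrt n / 2)" using sq \<kappa> by (simp add: field_simps)
      also have "\<dots> \<le> \<kappa> * card W" using mW \<kappa> by (intro mult_left_mono) auto
      finally have \<kappa>W: "4 \<le> \<kappa> * card W" .
      have g: "\<bar>f (real j / real n) - f (real i / real n)\<bar> \<le> b i" if j: "j \<in> W" for j
      proof -
        have in01: "real j / real n \<in> {0..1}" "real i / real n \<in> {0..1}"
          using i j W n1 by (auto simp: divide_le_eq_1)
        show ?thesis
        proof (cases "i \<in> S")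
          case True
          then show ?thesis using f01[OF in01(1)] f01[OF in01(2)] by (auto simp: b_def)
        next
          case False
          have "\<bar>real j - real i\<bar> \<le> real n * h" using j by (simp add: W_def window_def)
          then have "\<bar>real j - real i\<bar> / real n \<le> h" using n1 by (simp add: field_simps)
          then have close: "\<bar>real j / real n - real i / real n\<bar> \<le> h"
            by (simp add: diff_divide_distrib[symmetric])
          have "\<bar>f (real j / real n) - f (real i / real n)\<bar> \<le> \<beta> * \<bar>real j / real n - real i / real n\<bar>"
          proof (rule Lip[OF in01])
            fix k assume "k \<in> {1..N}"
            then have "h < \<bar>x k - real i / real n\<bar>" using False i by (force simp: S_def)
            then show "\<bar>real j / real n - real i / real n\<bar> < \<bar>x k - real i / real n\<bar>" using close by linarith
          qed
          also have "\<dots> \<le> \<beta> * h" using close \<beta> by (rule mult_left_mono)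
          finally show ?thesis using False by (simp add: b_def)
        qed
      qed
      have indZ: "indep_vars (\<lambda>_. borel) (Z n) W"
        by (rule indep_Z[OF W(3)])
      have tailZ: "\<exists>q>0. q \<le> 1/2 \<and> 4 * q * (1 - q) \<le> (1 + t\<^sup>2) powr (- \<kappa>) \<and>
          (\<forall>j\<in>W. prob {\<omega>\<in>space M. t < Z n j \<omega>} \<le> q \<and> prob {\<omega>\<in>space M. Z n j \<omega> < - t} \<le> q)" if "0 \<le> t" for t
      proof -
        have "prob {\<omega>\<in>space M. t < Z n j \<omega>} = noise.prob {t<..}" "prob {\<omega>\<in>space M. Z n j \<omega> < - t} = noise.prob {t<..}"
          if "j \<in> W" for j
          using that W prob_Z[of j n "{t<..}"] prob_Z[of j n "{..<- t}"] noise.prob_lessThan_minus[of t] by auto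
        then show ?thesis using tail[OF \<open>0 \<le> t\<close>] by auto
      qed
      have "(\<integral>\<^sup>+ \<omega>. ennreal ((empirical_median W (\<lambda>j. f (real j / real n) + \<sigma> * Z n j \<omega>) - f (real i / real n))\<^sup>2) \<partial>M)
          \<le> ennreal (2 * (b i)\<^sup>2 + 16 * \<sigma>\<^sup>2 / (\<kappa> * card W))"
        by (rule median_mean_square_le[OF indZ W(1,2) \<kappa> \<kappa>W \<sigma>_pos tailZ g])
      also have "\<dots> \<le> ennreal (2 * (b i)\<^sup>2 + 32 * \<sigma>\<^sup>2 / (\<kappa> * sqrt n))"
      proof (intro ennreal_leI add_left_mono)
        have "16 * \<sigma>\<^sup>2 / (\<kappa> * card W) \<le> 16 * \<sigma>\<^sup>2 / (\<kappa> * (sqrt n / 2))"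
          using mW \<kappa> n1 W by (intro divide_left_mono mult_left_mono mult_pos_pos) (auto simp: card_gt_0_iff)
        then show "16 * \<sigma>\<^sup>2 / (\<kappa> * card W) \<le> 32 * \<sigma>\<^sup>2 / (\<kappa> * sqrt n)" by simp
      qed
      finally show "(\<integral>\<^sup>+ \<omega>. ennreal ((median_filter n h (observation Z \<sigma> f n \<omega>) i - f (real i / real n))\<^sup>2) \<partial>M)
          \<le> ennreal (2 * (b i)\<^sup>2 + 32 * \<sigma>\<^sup>2 / (\<kappa> * sqrt n))"
        by (simp add: median_filter_def observation_def[abs_def] W_def)
    qed (use \<kappa> in auto)
    also have "\<dots> \<le> ennreal ((a + 6 * real N) / sqrt n)"
    proof (rule ennreal_leI)
      have "2 * (b i)\<^sup>2 + 32 * \<sigma>\<^sup>2 / (\<kappa> * sqrt n) \<le> a * h + (if i \<in> S then 2 else 0)" for i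
      proof -
        have "2 * (b i)\<^sup>2 \<le> 2 * \<beta>\<^sup>2 * h + (if i \<in> S then 2 else 0)"
        proof (cases "i \<in> S")
          case False
          have "h\<^sup>2 \<le> h" using h by (simp add: power2_eq_square mult_left_le)
          then show ?thesis using False mult_left_mono[of "h\<^sup>2" h "2 * \<beta>\<^sup>2"] by (simp add: b_def power_mult_distrib)
        qed (use h in \<open>simp add: b_def\<close>)
        then show ?thesis by (simp add: a_def h_def add_divide_distrib)
      qed
      then have "(\<Sum>i\<in>{1..n}. 2 * (b i)\<^sup>2 + 32 * \<sigma>\<^sup>2 / (\<kappa> * sqrt n))
          \<le> (\<Sum>i\<in>{1..n}. a * h + (if i \<in> S then 2 else 0))"
        by (rule sum_mono)
      also have "\<dots> = n * (a * h) + 2 * card S"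
      proof -
        have "{1..n} \<inter> {i. i \<in> S} = S" using S by auto
        then show ?thesis by (simp add: sum.distrib sum.If_cases)
      qed
      also have "\<dots> \<le> a * sqrt n + 6 * real N * sqrt n"
      proof -
        have "n * (a * h) = a * (real n * h)" by simp
        then have "n * (a * h) = a * sqrt n" unfolding h(3) .
        then show ?thesis using cS by linarith
      qed
      also have "\<dots> = (a + 6 * real N) * sqrt n" by (simp add: algebra_simps)
      finally have "(\<Sum>i\<in>{1..n}. 2 * (b i)\<^sup>2 + 32 * \<sigma>\<^sup>2 / (\<kappa> * sqrt n)) / n \<le> (a + 6 * real N) * sqrt n / n"
        by (intro divide_right_mono) auto
      also have "\<dots> = (a + 6 * real N) / sqrt n" using n1 by (simp add: field_simps)
      finally show "(\<Sum>i\<in>{1..n}. 2 * (b i)\<^sup>2 + 32 * \<sigma>\<^sup>2 / (\<kappa> * sqrt n)) / n \<le> (a + 6 * real N) / sqrt n" .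
    qed
    finally show "risk M Z \<sigma> n (median_filter n (1 / sqrt n)) f \<le> ennreal ((a + 6 * real N) / sqrt n)"
      unfolding h_def .
  qed
qed

end

theorem theorem2p2:
  fixes M :: "'a measure" and \<Psi> :: "real measure" and \<psi> :: "real \<Rightarrow> real"
    and Z :: "nat \<Rightarrow> nat \<Rightarrow> 'a \<Rightarrow> real"
    and \<sigma> \<beta> :: real and N :: nat
  assumes "prob_space M"
    and "white_noise M \<Psi> Z"
    and "shape_cond \<Psi> \<psi>"
    and "decay_exponent \<psi> > 1"
    and "\<sigma> > 0" and "N \<ge> 1" and "\<beta> > 0"
  shows "same_order
           (\<lambda>n. INF h\<in>{0<..}. worst_case_risk M Z \<sigma> n (median_filter n h) (PLIP \<beta> N))
           (\<lambda>n. ennreal (real n powr (- 1 / 2)))"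
proof -
  interpret prob_space M by fact
  interpret noisy_observations M \<Psi> \<psi> Z \<sigma>
    by unfold_locales fact+
  let ?R = "\<lambda>n h. worst_case_risk M Z \<sigma> n (median_filter n h) (PLIP \<beta> N)"
  obtain c1 where c1: "0 < c1" and narrow: "\<And>n h. 1 \<le> n \<Longrightarrow> 0 < h \<Longrightarrow> h \<le> 1 / sqrt n \<Longrightarrow>
      ennreal (c1 / sqrt n) \<le> risk M Z \<sigma> n (median_filter n h) (\<lambda>_. 0)"
    using risk_zero_ge by blast
  obtain c2 n2 where c2: "0 < c2" and wide: "\<And>n h. n2 \<le> n \<Longrightarrow> 1 / sqrt n \<le> h \<Longrightarrow>
      ennreal (c2 / sqrt n) \<le> risk M Z \<sigma> n (median_filter n h) (\<lambda>t. if 1/2 < t then 1 else 0)"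
    using risk_step_ge by blast
  obtain C n3 where C: "0 < C" and upper: "\<And>n f. n3 \<le> n \<Longrightarrow> f \<in> PLIP \<beta> N \<Longrightarrow>
      risk M Z \<sigma> n (median_filter n (1 / sqrt n)) f \<le> ennreal (C / sqrt n)"
    using risk_PLIP_le[OF assms(4), of \<beta> N] assms(7) by auto
  have zero: "(\<lambda>_. 0) \<in> PLIP \<beta> N" and step: "(\<lambda>t. if 1/2 < t then 1 else 0) \<in> PLIP \<beta> N"
    using step_in_PLIP[of N \<beta> 0] step_in_PLIP[of N \<beta> 1] assms(6,7) by simp_all
  define c where "c = min c1 c2"
  have c: "0 < c" "c \<le> c1" "c \<le> c2" using c1 c2 by (auto simp: c_def)
  have bounds: "ennreal c \<le> (INF h\<in>{0<..}. ?R n h) / ennreal (real n powr (- 1 / 2)) \<and>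
      (INF h\<in>{0<..}. ?R n h) / ennreal (real n powr (- 1 / 2)) \<le> ennreal C"
    if "max 1 (max n2 n3) \<le> n" for n
  proof -
    have n: "1 \<le> n" "n2 \<le> n" "n3 \<le> n" using that by auto
    have sq: "0 < sqrt n" using n by simp
    have rate: "real n powr (- 1 / 2) = 1 / sqrt n"
      using n by (simp add: powr_minus powr_half_sqrt field_simps)
    have cancel: "ennreal (r / sqrt n) / ennreal (1 / sqrt n) = ennreal r" if "0 < r" for r
      using that sq by (subst divide_ennreal) auto
    have "ennreal (c / sqrt n) \<le> (INF h\<in>{0<..}. ?R n h)"
    proof (rule INF_greatest)
      fix h :: real assume "h \<in> {0<..}"
      then have h: "0 < h" by simp
      show "ennreal (c / sqrt n) \<le> ?R n h"
      proof (cases "h \<le> 1 / sqrt n")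
        case True
        have "ennreal (c / sqrt n) \<le> ennreal (c1 / sqrt n)"
          using c sq by (intro ennreal_leI divide_right_mono) auto
        also note narrow[OF n(1) h True]
        also have "risk M Z \<sigma> n (median_filter n h) (\<lambda>_. 0) \<le> ?R n h"
          unfolding worst_case_risk_def by (rule SUP_upper[OF zero])
        finally show ?thesis .
      next
        case False
        have "ennreal (c / sqrt n) \<le> ennreal (c2 / sqrt n)"
          using c sq by (intro ennreal_leI divide_right_mono) auto
        also have "\<dots> \<le> risk M Z \<sigma> n (median_filter n h) (\<lambda>t. if 1/2 < t then 1 else 0)"
          using False by (intro wide n) simp
        also have "\<dots> \<le> ?R n h"
          unfolding worst_case_risk_def by (rule SUP_upper[OF step])
        finally show ?thesis .
      qed
    qed
    then have "ennreal (c / sqrt n) / ennreal (1 / sqrt n) \<le> (INF h\<in>{0<..}. ?R n h) / ennreal (1 / sqrt n)"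
      by (rule divide_right_mono_ennreal)
    moreover have "(INF h\<in>{0<..}. ?R n h) \<le> ennreal (C / sqrt n)"
    proof (rule INF_lower2)
      show "1 / sqrt n \<in> {0<..}" using sq by simp
      show "?R n (1 / sqrt n) \<le> ennreal (C / sqrt n)"
        unfolding worst_case_risk_def by (intro SUP_least upper n)
    qed
    then have "(INF h\<in>{0<..}. ?R n h) / ennreal (1 / sqrt n) \<le> ennreal (C / sqrt n) / ennreal (1 / sqrt n)"
      by (rule divide_right_mono_ennreal)
    ultimately show ?thesis
      unfolding rate cancel[OF c(1)] cancel[OF C] by blast
  qed
  show ?thesis
    unfolding same_order_def
    using c(1) bounds eventually_ge_at_top[of "max 1 (max n2 n3)"]
    by (intro exI[of _ c] exI[of _ C]) (auto elim!: eventually_mono)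
qed

end
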